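(* Let $G$ be a finite cyclic group, let $S$ be a Schur ring over $\mathbb{Q}[G]$, and let $\varepsilon\in S$ be an idempotent. Then $\varepsilon\in\mathrm{Span}_{\mathbb{Q}}\{\overline{H}\mid H\le G,\ \overline{H}\in S\}$.
   Context: For $A\subseteq G$ write $\overline{A}=\sum_{g\in A}g$. A Schur ring over $\mathbb{Q}[G]$ is a subspace $S=\mathrm{Span}_{\mathbb{Q}}\{\overline{C_1},\dots,\overline{C_r}\}$ of $\mathbb{Q}[G]$, where $\{C_1,\dots,C_r\}$ is a partition of $G$ with $C_1=\{1\}$, such that for each $i$ there is $j$ with $C_i^{-1}=C_j$, and for all $i,j$ the product $\overline{C_i}\,\overline{C_j}$ is a $\mathbb{Q}$-linear combination of the $\overline{C_k}$. *)

theory Defs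
  imports
    "HOL-Algebra.Elementary_Groups"
    "HOL-Algebra.Ring"
    "HOL-Library.Function_Algebras"
    "HOL-Library.Indicator_Function"
    "HOL-Library.Disjoint_Sets"
begin

definition rat_scale :: "rat \<Rightarrow> ('a \<Rightarrow> rat) \<Rightarrow> 'a \<Rightarrow> rat" where
  "rat_scale c f = (\<lambda>x. c * f x)"

global_interpretation rat_fun: vector_space rat_scale
  by standard (auto simp: rat_scale_def algebra_simps)

(* The group algebra of G over the rationals, for finite G: the formal sum of f(g) g over
   g in G is the function f, extended by 0 outside the carrier.  The product is convolution
   (the index set below is empty for x outside the carrier); it is not the pointwise product
   of functions.  The element "sum of all g in A" is the function "indicator A". *)
definition rat_group_algebra :: "('a, 'b) monoid_scheme \<Rightarrow> ('a \<Rightarrow> rat) ring" where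
  "rat_group_algebra G =
    \<lparr>carrier = {f. \<forall>x. x \<notin> carrier G \<longrightarrow> f x = 0},
     monoid.mult = (\<lambda>f g x.
       \<Sum>(y, z) \<in> {(y, z) \<in> carrier G \<times> carrier G. y \<otimes>\<^bsub>G\<^esub> z = x}. f y * g z),
     one = indicator {\<one>\<^bsub>G\<^esub>},
     zero = 0,
     add = (+)\<rparr>"

definition schur_ring :: "('a, 'b) monoid_scheme \<Rightarrow> ('a \<Rightarrow> rat) set \<Rightarrow> bool" where
  "schur_ring G S \<longleftrightarrow>
    (\<exists>P. partition_on (carrier G) P \<and>
         {\<one>\<^bsub>G\<^esub>} \<in> P \<and>
         (\<forall>C\<in>P. set_inv\<^bsub>G\<^esub> C \<in> P) \<and>
         (\<forall>C\<in>P. \<forall>D\<in>P. indicator C \<otimes>\<^bsub>rat_group_algebra G\<^esub> indicator D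
            \<in> rat_fun.span (indicator ` P)) \<and>
         S = rat_fun.span (indicator ` P))"

lemma rat_group_algebra_mult:
  assumes "group G" "x \<in> carrier G"
  shows "(f \<otimes>\<^bsub>rat_group_algebra G\<^esub> g) x
    = (\<Sum>y\<in>carrier G. f y * g (inv\<^bsub>G\<^esub> y \<otimes>\<^bsub>G\<^esub> x))"
proof -
  interpret group G by fact
  show ?thesis
    unfolding rat_group_algebra_def monoid.simps
    by (rule sum.reindex_bij_witness[of _ "\<lambda>y. (y, inv\<^bsub>G\<^esub> y \<otimes>\<^bsub>G\<^esub> x)" fst])
       (use assms(2) in \<open>auto simp: inv_solve_left m_assoc[symmetric]\<close>)
qed

lemma ring_rat_group_algebra:
  assumes "group G" "finite (carrier G)"
  shows "ring (rat_group_algebra G)"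
proof -
  interpret group G by fact
  let ?R = "rat_group_algebra G"
  have out: "(f \<otimes>\<^bsub>?R\<^esub> g) x = 0" if "x \<notin> carrier G" for f g x
    unfolding rat_group_algebra_def monoid.simps
    by (rule sum.neutral) (use that in auto)
  note mult = rat_group_algebra_mult[OF assms(1)]
  show ?thesis
  proof (rule ringI)
    show "abelian_group ?R"
    proof (rule abelian_groupI)
      fix f assume "f \<in> carrier ?R"
      then show "\<exists>g\<in>carrier ?R. g \<oplus>\<^bsub>?R\<^esub> f = \<zero>\<^bsub>?R\<^esub>"
        by (intro bexI[of _ "- f"]) (auto simp: rat_group_algebra_def fun_Compl_def fun_eq_iff)
    qed (auto simp: rat_group_algebra_def algebra_simps)
    show "monoid ?R"
    proof (rule monoidI)
      fix f g assume "f \<in> carrier ?R" "g \<in> carrier ?R"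
      show "f \<otimes>\<^bsub>?R\<^esub> g \<in> carrier ?R"
        using out by (simp add: rat_group_algebra_def)
    next
      show "\<one>\<^bsub>?R\<^esub> \<in> carrier ?R"
        by (auto simp: rat_group_algebra_def indicator_def)
    next
      fix f g h assume "f \<in> carrier ?R" "g \<in> carrier ?R" "h \<in> carrier ?R"
      show "f \<otimes>\<^bsub>?R\<^esub> g \<otimes>\<^bsub>?R\<^esub> h = f \<otimes>\<^bsub>?R\<^esub> (g \<otimes>\<^bsub>?R\<^esub> h)"
      proof
        fix x
        show "(f \<otimes>\<^bsub>?R\<^esub> g \<otimes>\<^bsub>?R\<^esub> h) x = (f \<otimes>\<^bsub>?R\<^esub> (g \<otimes>\<^bsub>?R\<^esub> h)) x"
        proof (cases "x \<in> carrier G")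
          case True
          have "(f \<otimes>\<^bsub>?R\<^esub> g \<otimes>\<^bsub>?R\<^esub> h) x
            = (\<Sum>y\<in>carrier G. \<Sum>z\<in>carrier G.
                 f z * g (inv\<^bsub>G\<^esub> z \<otimes>\<^bsub>G\<^esub> y) * h (inv\<^bsub>G\<^esub> y \<otimes>\<^bsub>G\<^esub> x))"
            using True by (simp add: mult sum_distrib_right)
          also have "\<dots> = (\<Sum>z\<in>carrier G. \<Sum>y\<in>carrier G.
                 f z * g (inv\<^bsub>G\<^esub> z \<otimes>\<^bsub>G\<^esub> y) * h (inv\<^bsub>G\<^esub> y \<otimes>\<^bsub>G\<^esub> x))"
            by (rule sum.swap)
          also have "\<dots> = (\<Sum>z\<in>carrier G. \<Sum>u\<in>carrier G.
                 f z * g u * h (inv\<^bsub>G\<^esub> u \<otimes>\<^bsub>G\<^esub> (inv\<^bsub>G\<^esub> z \<otimes>\<^bsub>G\<^esub> x)))"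
          proof (rule sum.cong[OF refl])
            fix z assume z: "z \<in> carrier G"
            show "(\<Sum>y\<in>carrier G.
                 f z * g (inv\<^bsub>G\<^esub> z \<otimes>\<^bsub>G\<^esub> y) * h (inv\<^bsub>G\<^esub> y \<otimes>\<^bsub>G\<^esub> x))
              = (\<Sum>u\<in>carrier G.
                 f z * g u * h (inv\<^bsub>G\<^esub> u \<otimes>\<^bsub>G\<^esub> (inv\<^bsub>G\<^esub> z \<otimes>\<^bsub>G\<^esub> x)))"
              by (rule sum.reindex_bij_witness
                    [of _ "\<lambda>u. z \<otimes>\<^bsub>G\<^esub> u" "\<lambda>y. inv\<^bsub>G\<^esub> z \<otimes>\<^bsub>G\<^esub> y"])
                 (use z True in \<open>auto simp: m_assoc[symmetric] inv_mult_group\<close>,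
                  simp add: m_assoc)
          qed
          also have "\<dots> = (f \<otimes>\<^bsub>?R\<^esub> (g \<otimes>\<^bsub>?R\<^esub> h)) x"
            using True by (simp add: mult sum_distrib_left mult.assoc)
          finally show ?thesis .
        qed (simp add: out)
      qed
    next
      fix f assume f: "f \<in> carrier ?R"
      have f0: "f x = 0" if "x \<notin> carrier G" for x
        using f that by (simp add: rat_group_algebra_def)
      have one: "\<one>\<^bsub>?R\<^esub> = indicator {\<one>\<^bsub>G\<^esub>}"
        by (simp add: rat_group_algebra_def)
      show "\<one>\<^bsub>?R\<^esub> \<otimes>\<^bsub>?R\<^esub> f = f"
      proof
        fix x
        show "(\<one>\<^bsub>?R\<^esub> \<otimes>\<^bsub>?R\<^esub> f) x = f x"
        proof (cases "x \<in> carrier G")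
          case True
          then have "(\<one>\<^bsub>?R\<^esub> \<otimes>\<^bsub>?R\<^esub> f) x
            = (\<Sum>y\<in>carrier G. if y = \<one>\<^bsub>G\<^esub> then f (inv\<^bsub>G\<^esub> y \<otimes>\<^bsub>G\<^esub> x) else 0)"
            by (auto simp: mult one intro!: sum.cong)
          then show ?thesis using True assms(2) by (simp add: sum.delta)
        qed (simp add: out f0)
      qed
      show "f \<otimes>\<^bsub>?R\<^esub> \<one>\<^bsub>?R\<^esub> = f"
      proof
        fix x
        show "(f \<otimes>\<^bsub>?R\<^esub> \<one>\<^bsub>?R\<^esub>) x = f x"
        proof (cases "x \<in> carrier G")
          case True
          have "inv\<^bsub>G\<^esub> y \<otimes>\<^bsub>G\<^esub> x = \<one>\<^bsub>G\<^esub> \<longleftrightarrow> y = x" if "y \<in> carrier G" for y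
            using that True by (metis inv_closed inv_equality inv_inv l_inv)
          then have "(f \<otimes>\<^bsub>?R\<^esub> \<one>\<^bsub>?R\<^esub>) x
            = (\<Sum>y\<in>carrier G. if y = x then f y else 0)"
            using True by (auto simp: mult one indicator_def intro!: sum.cong)
          then show ?thesis using True assms(2) by (simp add: sum.delta)
        qed (simp add: out f0)
      qed
    qed
  qed (auto simp: rat_group_algebra_def fun_eq_iff case_prod_beta sum.distrib algebra_simps)
qed

end

theory Submission
  imports
    Defs
    "HOL-Algebra.Multiplicative_Group"
    "HOL-Computational_Algebra.Primes"
    "HOL-Computational_Algebra.Polynomial"
begin

text \<open>
  Identify \<open>G\<close> with \<open>\<int>/n\<close>. Raising to the \<open>p\<close>-th power, \<open>p\<close> prime, in the group ring is, modulo \<open>p\<close>, the map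
  induced by \<open>x \<mapsto> x\<^sup>p\<close>. For large primes \<open>p\<close> this forces an idempotent to be constant on the generators
  of each subgroup, so it lies in the rational part of the Schur ring.

  For rational Schur rings we show that two elements contained in the same subgroups \<open>H\<close> with
  indicator in \<open>S\<close> lie in the same class; a Stone-Weierstrass argument then finishes the proof. Let
  \<open>T\<close> be a class, \<open>H\<close> the smallest such subgroup containing \<open>T\<close> and \<open>h\<close> a generator of \<open>H\<close>. By
  descending induction on subgroups \<open>N \<le> H\<close> with indicator in \<open>S\<close>, \<open>h \<in> T + N\<close>. Given \<open>N < H\<close>, let
  \<open>p\<close> divide the index, let \<open>N' = N + m\<int>\<close> contain \<open>N\<close> with index \<open>p\<close>, and let \<open>A = T + N\<close>. The
  \<open>p\<close>-th power of \<open>A\<close>, read modulo \<open>p\<close>, detects the \<open>N'\<close>-cosets that meet \<open>A\<close> but are not contained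
  in it: it yields a set \<open>Q\<close> in the Schur ring, disjoint from \<open>A\<close> and free of generators of \<open>H\<close>,
  such that \<open>A \<union> Q\<close> is stable under \<open>N'\<close>. The stabilizer of \<open>A \<union> Q\<close> belongs to the Schur ring and
  is larger than \<open>N\<close>, so the induction hypothesis gives \<open>h \<in> A \<union> Q\<close>, hence \<open>h \<in> A\<close>.
\<close>

section \<open>Prime powers in cyclic group rings\<close>

lemma of_nat_dvd:
  assumes "m dvd n"
  shows "(of_nat m :: 'a :: comm_semiring_1) dvd of_nat n"
  using assms by (auto elim!: dvdE)

text \<open>The inner binomial coefficients of a prime \<open>p\<close> are divisible by
  \<open>p\<close> (Frobenius congruence).\<close>

lemma prime_dvd_power_add_diff:
  fixes a b :: "'a :: comm_ring_1"
  assumes "prime p"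
  shows "of_nat p dvd (a + b) ^ p - (a ^ p + b ^ p)"
proof -
  have p: "p > 0" using assms by (simp add: prime_gt_0_nat)
  let ?t = "\<lambda>k. of_nat (p choose k) * a ^ k * b ^ (p - k)"
  have "(a + b) ^ p = (\<Sum>k\<in>{..p}. ?t k)"
    by (rule binomial_ring)
  also have "{..p} = insert 0 (insert p {0<..<p})" using p by auto
  also have "(\<Sum>k\<in>\<dots>. ?t k) = a ^ p + b ^ p + (\<Sum>k\<in>{0<..<p}. ?t k)"
    using p by simp
  finally have "(a + b) ^ p - (a ^ p + b ^ p) = (\<Sum>k\<in>{0<..<p}. ?t k)" by simp
  also have "of_nat p dvd \<dots>"
    by (intro dvd_sum dvd_mult2) (use assms p in \<open>auto intro!: of_nat_dvd dvd_choose_prime\<close>)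
  finally show ?thesis .
qed

lemma prime_dvd_power_sum_diff:
  fixes a :: "'i \<Rightarrow> 'a :: comm_ring_1"
  assumes "prime p" "finite I"
  shows "of_nat p dvd (\<Sum>i\<in>I. a i) ^ p - (\<Sum>i\<in>I. a i ^ p)"
  using assms(2)
proof induction
  case empty
  then show ?case using assms(1) by (simp add: prime_gt_0_nat power_0_left)
next
  case (insert i I)
  have "of_nat p dvd ((a i + sum a I) ^ p - (a i ^ p + sum a I ^ p))
      + (sum a I ^ p - (\<Sum>i\<in>I. a i ^ p))"
    by (intro dvd_add prime_dvd_power_add_diff assms insert.IH)
  then show ?case using insert.hyps by (simp add: algebra_simps)
qed

text \<open>Fermat's little theorem: a natural number is a sum of ones, to which the Frobenius
  congruence applies.\<close>

lemma prime_dvd_power_diff_int: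
  fixes a :: int
  assumes "prime p"
  shows "int p dvd a ^ p - a"
proof -
  have nat: "int p dvd int n ^ p - int n" for n
    using prime_dvd_power_sum_diff[OF assms, of "{..<n}" "\<lambda>_. 1 :: int"] by simp
  show ?thesis
  proof (cases "a \<ge> 0")
    case True
    then show ?thesis using nat[of "nat a"] by simp
  next
    case False
    \<comment> \<open>Using \<open>a + (- a) = 0\<close> treats \<open>p = 2\<close> and odd
      \<open>p\<close> alike.\<close>
    have "int p dvd (a + (- a)) ^ p - (a ^ p + (- a) ^ p)"
      by (rule prime_dvd_power_add_diff[OF assms, where 'a = int, simplified])
    moreover have "int p dvd (- a) ^ p - (- a)" using nat[of "nat (- a)"] False by simp
    ultimately have "int p dvd (a + (- a)) ^ p - (a ^ p + (- a) ^ p) + ((- a) ^ p - (- a))"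
      by (rule dvd_add)
    then have "int p dvd - (a ^ p - a)" using assms by (simp add: prime_gt_0_nat power_0_left)
    then show ?thesis using dvd_minus_iff by blast
  qed
qed

text \<open>Reduced modulo \<open>n\<close>, the substitution \<open>g\<close> is an injective
  self-map of \<open>{..<n}\<close>, hence a permutation. Used for translations and for
  multiplication by units.\<close>

lemma sum_mod_period:
  fixes F :: "int \<Rightarrow> 'a :: comm_monoid_add"
  assumes "n > 0" and per: "\<And>i j. int n dvd i - j \<Longrightarrow> F i = F j"
    and inj: "\<And>i j. int n dvd g i - g j \<Longrightarrow> int n dvd i - j"
  shows "(\<Sum>i<n. F (g (int i))) = (\<Sum>i<n. F (int i))"
proof -
  let ?h = "\<lambda>i. nat (g (int i) mod int n)"
  have dvd: "int n dvd g (int i) - int (?h i)" for i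
    using assms(1) by (simp add: minus_mod_eq_mult_div)
  have "inj_on ?h {..<n}"
  proof (rule inj_onI)
    fix i j assume ij: "i \<in> {..<n}" "j \<in> {..<n}" "?h i = ?h j"
    then have "int n dvd (g (int i) - int (?h i)) - (g (int j) - int (?h j))"
      by (intro dvd_diff[OF dvd dvd])
    then have "int n dvd int i - int j" using inj ij(3) by simp
    then have "int i mod int n = int j mod int n" by (simp add: mod_eq_dvd_iff)
    then show "i = j" using ij by simp
  qed
  moreover have "?h ` {..<n} \<subseteq> {..<n}"
    using assms(1) by (auto simp: nat_less_iff)
  ultimately have "bij_betw ?h {..<n} {..<n}"
    by (simp add: bij_betw_def endo_inj_surj)
  then have "(\<Sum>i<n. F (int i)) = (\<Sum>i<n. F (int (?h i)))"
    by (rule sum.reindex_bij_betw[symmetric])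
  also have "\<dots> = (\<Sum>i<n. F (g (int i)))"
    using per[OF dvd] by (intro sum.cong) auto
  finally show ?thesis by simp
qed

text \<open>All \<open>m\<close> blocks of length \<open>k\<close> contribute the same. This
  compares convolution modulo \<open>n\<close> with convolution modulo a divisor.\<close>

lemma sum_multiple_period:
  fixes F :: "int \<Rightarrow> int"
  assumes per: "\<And>i. F (i + int k) = F i"
  shows "(\<Sum>i<m * k. F (int i)) = int m * (\<Sum>i<k. F (int i))"
proof -
  have shift: "F (int (i + l * k)) = F (int i)" for i l
  proof (induction l)
    case (Suc l)
    then show ?case using per[of "int (i + l * k)"] by (simp add: algebra_simps)
  qed simp
  have "(\<Sum>i<m * k. F (int i)) = (\<Sum>l<m. \<Sum>i\<in>{l * k..<l * k + k}. F (int i))"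
    by (rule sum.nat_group[symmetric])
  also have "\<dots> = (\<Sum>l<m. \<Sum>i<k. F (int i))"
  proof (rule sum.cong[OF refl])
    fix l
    have "(\<Sum>i\<in>{l * k..<l * k + k}. F (int i)) = (\<Sum>i\<in>{0..<k}. F (int (i + l * k)))"
      using sum.shift_bounds_nat_ivl[of "\<lambda>i. F (int i)" 0 "l * k" k] by (simp add: add.commute)
    then show "(\<Sum>i\<in>{l * k..<l * k + k}. F (int i)) = (\<Sum>i<k. F (int i))"
      by (simp add: shift lessThan_atLeast0 del: of_nat_add)
  qed
  finally show ?thesis by simp
qed

text \<open>For \<open>k\<close>-periodic functions this is the convolution over \<open>\<int>/k\<close>.\<close>

definition conv :: "nat \<Rightarrow> (int \<Rightarrow> int) \<Rightarrow> (int \<Rightarrow> int) \<Rightarrow> int \<Rightarrow> int" where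
  "conv k f g y = (\<Sum>i<k. f (int i) * g (y - int i))"

primrec conv_power :: "nat \<Rightarrow> (int \<Rightarrow> int) \<Rightarrow> nat \<Rightarrow> int \<Rightarrow> int" where
  "conv_power k f 0 = (\<lambda>y. of_bool (int k dvd y))"
| "conv_power k f (Suc j) = conv k f (conv_power k f j)"

text \<open>The coefficient at \<open>y\<close> of the image of \<open>F\<close> in \<open>\<int>[X]/(X\<^sup>k - 1)\<close>.\<close>

definition residue_coeff :: "nat \<Rightarrow> int poly \<Rightarrow> int \<Rightarrow> int" where
  "residue_coeff k F y = (\<Sum>i\<le>degree F. coeff F i * of_bool (int k dvd y - int i))"

section \<open>Reduction of integer polynomials modulo \<open>X^k - 1\<close>\<close>

lemma residue_coeff_eq:
  assumes "degree F \<le> M"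
  shows "residue_coeff k F y = (\<Sum>i\<le>M. coeff F i * of_bool (int k dvd y - int i))"
  unfolding residue_coeff_def
  by (rule sum.mono_neutral_left) (use assms in \<open>auto simp: coeff_eq_0\<close>)

lemma residue_coeff_0 [simp]: "residue_coeff k 0 y = 0"
  by (simp add: residue_coeff_def)

lemma residue_coeff_add: "residue_coeff k (F + G) y = residue_coeff k F y + residue_coeff k G y"
proof -
  let ?M = "max (degree F) (degree G)"
  have "degree (F + G) \<le> ?M" by (rule degree_add_le_max)
  then show ?thesis
    by (simp add: residue_coeff_eq[of _ ?M] sum.distrib algebra_simps)
qed

lemma residue_coeff_sum:
  "residue_coeff k (\<Sum>i\<in>I. F i) y = (\<Sum>i\<in>I. residue_coeff k (F i) y)"
  by (induction I rule: infinite_finite_induct) (auto simp: residue_coeff_add)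

lemma residue_coeff_smult: "residue_coeff k (smult c F) y = c * residue_coeff k F y"
  unfolding residue_coeff_eq[OF degree_smult_le]
  unfolding residue_coeff_def
  by (simp only: coeff_smult sum_distrib_left mult.assoc)

lemma residue_coeff_monom: "residue_coeff k (monom c i) y = c * of_bool (int k dvd y - int i)"
proof -
  have "residue_coeff k (monom c i) y
      = (\<Sum>j\<le>i. coeff (monom c i) j * of_bool (int k dvd y - int j))"
    by (rule residue_coeff_eq) (rule degree_monom_le)
  also have "\<dots> = (\<Sum>j\<le>i. if j = i then c * of_bool (int k dvd y - int j) else 0)"
    by (intro sum.cong) auto
  finally show ?thesis by simp
qed

lemma residue_coeff_monom_mult:
  "residue_coeff k (monom c i * F) y = c * residue_coeff k F (y - int i)"
proof -
  have "monom c i * F = (\<Sum>j\<le>degree F. monom (c * coeff F j) (i + j))"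
    by (subst poly_as_sum_of_monoms[of F, symmetric]) (simp add: sum_distrib_left mult_monom)
  then have "residue_coeff k (monom c i * F) y
      = (\<Sum>j\<le>degree F. c * (coeff F j * of_bool (int k dvd y - int i - int j)))"
    by (simp only: residue_coeff_sum residue_coeff_monom mult.assoc of_nat_add diff_diff_eq)
  then show ?thesis
    by (simp only: residue_coeff_def sum_distrib_left)
qed

text \<open>Polynomials form a commutative ring type, so the Frobenius congruence holds for them;
  this identity carries it over to convolution.\<close>

lemma residue_coeff_power:
  "residue_coeff k ((\<Sum>i<k. monom (f (int i)) i) ^ j) y = conv_power k f j y"
proof (induction j arbitrary: y)
  case 0
  show ?case using residue_coeff_monom[of k 1 0 y] by simp
next
  case (Suc j)
  then show ?case
    by (simp add: sum_distrib_right residue_coeff_sum residue_coeff_monom_mult conv_def)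
qed

text \<open>Frobenius splits the power of a sum into powers of monomials, and Fermat removes the
  exponent from the coefficients. So modulo \<open>p\<close> the \<open>p\<close>-th power is the
  push-forward of \<open>f\<close> under multiplication by \<open>p\<close>.\<close>

lemma conv_power_prime:
  assumes "prime p"
  shows "int p dvd conv_power k f p y - (\<Sum>i<k. f (int i) * of_bool (int k dvd y - int (p * i)))"
proof -
  let ?F = "\<lambda>i. monom (f (int i)) i"
  have "of_nat p dvd (\<Sum>i<k. ?F i) ^ p - (\<Sum>i<k. ?F i ^ p)"
    by (rule prime_dvd_power_sum_diff[OF assms]) simp
  then obtain K where "(\<Sum>i<k. ?F i) ^ p - (\<Sum>i<k. ?F i ^ p) = of_nat p * K" ..
  then have "(\<Sum>i<k. ?F i) ^ p = (\<Sum>i<k. ?F i ^ p) + smult (int p) K"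
    by (simp add: of_nat_poly algebra_simps)
  then have "conv_power k f p y
      = (\<Sum>i<k. f (int i) ^ p * of_bool (int k dvd y - int (p * i))) + int p * residue_coeff k K y"
    by (simp add: residue_coeff_power[symmetric] residue_coeff_add residue_coeff_sum monom_power
        residue_coeff_monom residue_coeff_smult mult.commute)
  then have "conv_power k f p y - (\<Sum>i<k. f (int i) * of_bool (int k dvd y - int (p * i)))
      = (\<Sum>i<k. (f (int i) ^ p - f (int i)) * of_bool (int k dvd y - int (p * i)))
        + int p * residue_coeff k K y"
    by (simp add: sum_subtractf algebra_simps)
  also have "int p dvd \<dots>"
    by (intro dvd_add dvd_sum dvd_mult2 prime_dvd_power_diff_int[OF assms] dvd_triv_left)
  finally show ?thesis .
qed

section \<open>Invariance of idempotents under units\<close>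

text \<open>A unit modulo \<open>b\<close> lifts to a unit modulo \<open>n\<close>: take for
  \<open>t\<close> the product of the primes that divide \<open>n\<close> but not \<open>a\<close>.
  Each prime factor of \<open>n\<close> then divides exactly one of \<open>a\<close> and
  \<open>b * t\<close>.\<close>

lemma coprime_add_mult_exists:
  fixes a b n :: int
  assumes "coprime a b" "n \<noteq> 0"
  shows "\<exists>t. coprime (a + b * t) n"
proof -
  let ?S = "{q \<in> prime_factors n. \<not> q dvd a}"
  define t where "t = \<Prod>?S"
  have "coprime (a + b * t) n"
  proof (rule ccontr)
    assume "\<not> coprime (a + b * t) n"
    moreover have "gcd (a + b * t) n \<noteq> 0" using assms(2) by simp
    ultimately obtain q where q: "prime q" "q dvd gcd (a + b * t) n"
      by (metis coprime_iff_gcd_eq_1 is_unit_gcd prime_divisor_exists coprime_def)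
    then have qa: "q dvd a + b * t" and qn: "q dvd n" by auto
    show False
    proof (cases "q dvd a")
      case True
      then have "q dvd b * t" using qa by (simp add: dvd_add_right_iff)
      moreover have "\<not> q dvd b"
        using assms(1) True q(1) by (meson coprime_common_divisor not_prime_unit)
      ultimately have "q dvd t" using q(1) by (simp add: prime_dvd_mult_iff)
      then obtain q' where q': "q' \<in> ?S" "q dvd q'"
        unfolding t_def using q(1) by (subst (asm) prime_dvd_prod_iff) auto
      then have "q = q'" using q(1) by (auto simp: in_prime_factors_iff primes_dvd_imp_eq)
      then show False using q' True by simp
    next
      case False
      then have "q \<in> ?S" using q(1) qn assms(2) by (simp add: in_prime_factors_iff)
      then have "q dvd t" unfolding t_def by (intro dvd_prodI) auto
      then have "q dvd a" using qa by (simp add: dvd_add_left_iff)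
      then show False using False by simp
    qed
  qed
  then show ?thesis ..
qed

text \<open>The sum is a convolution with the indicator of the multiples of \<open>n\<close>, which
  is neutral for \<open>n\<close>-periodic functions.\<close>

lemma sum_delta_mod:
  fixes f :: "int \<Rightarrow> int"
  assumes "n > 0" and per: "\<And>i j. int n dvd i - j \<Longrightarrow> f i = f j"
  shows "(\<Sum>i<n. f (int i) * of_bool (int n dvd y - int i)) = f y"
proof -
  let ?r = "nat (y mod int n)"
  have r: "int n dvd y - int ?r" "?r < n"
    using assms(1) by (simp_all add: minus_mod_eq_mult_div nat_less_iff)
  have "(\<Sum>i<n. f (int i) * of_bool (int n dvd y - int i)) = (\<Sum>i<n. if i = ?r then f y else 0)"
  proof (rule sum.cong[OF refl])
    fix i assume i: "i \<in> {..<n}"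
    show "f (int i) * of_bool (int n dvd y - int i) = (if i = ?r then f y else 0)"
    proof (cases "int n dvd y - int i")
      case True
      then have "y mod int n = int i mod int n" by (simp add: mod_eq_dvd_iff)
      then have "i = ?r" using i by simp
      then show ?thesis using True per[OF True] by simp
    next
      case False
      then have "i \<noteq> ?r" using r by blast
      then show ?thesis using False by simp
    qed
  qed
  also have "\<dots> = f y" using r(2) by simp
  finally show ?thesis .
qed

text \<open>Here \<open>f\<close> stands for a rational idempotent multiplied by a common
  denominator \<open>D\<close>; idempotency then reads as \<open>idem\<close>.\<close>

context
  fixes n :: nat and f :: "int \<Rightarrow> int" and D :: int
  assumes n: "n > 0" and D: "D > 0"
    and per: "\<And>i j. int n dvd i - j \<Longrightarrow> f i = f j"
    and idem: "\<And>y. conv n f f y = D * f y"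
begin

lemma idempotent_conv_power: "conv_power n f (Suc j) y = D ^ j * f y"
proof (induction j arbitrary: y)
  case 0
  then show ?case using sum_delta_mod[OF n per] by (simp add: conv_def)
next
  case (Suc j)
  have "conv_power n f (Suc (Suc j)) y = D ^ j * conv n f f y"
    unfolding conv_power.simps(2)[of n f "Suc j"] conv_def
    by (simp only: Suc sum_distrib_left mult.left_commute)
  then show ?case by (simp add: idem)
qed

text \<open>The \<open>p\<close>-th convolution power is \<open>D ^ (p - 1) * f\<close>, congruent
  to \<open>f\<close> by Fermat, but also to the push-forward of \<open>f\<close> under
  multiplication by \<open>p\<close>. Hence \<open>f (p * x)\<close> and \<open>f x\<close> agree
  modulo \<open>p\<close>, and the bound turns this into equality.\<close>

lemma idempotent_prime_mult:
  assumes p: "prime p" "\<not> p dvd n" "\<not> int p dvd D" and bound: "\<And>y. 2 * \<bar>f y\<bar> < int p"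
  shows "f (int p * x) = f x"
proof -
  have cop: "coprime (int n) (int p)"
    using p by (metis prime_imp_coprime coprime_commute coprime_int_iff)
  have "(\<Sum>i<n. f (int i) * of_bool (int n dvd int p * x - int (p * i)))
      = (\<Sum>i<n. f (int i) * of_bool (int n dvd x - int i))"
    using cop by (simp add: coprime_dvd_mult_right_iff flip: right_diff_distrib)
  then have sum: "(\<Sum>i<n. f (int i) * of_bool (int n dvd int p * x - int (p * i))) = f x"
    using sum_delta_mod[OF n per] by simp
  obtain j where j: "p = Suc j" using p(1) prime_gt_0_nat gr0_implies_Suc by blast
  have "int p dvd D * (D ^ j - 1)"
    using prime_dvd_power_diff_int[OF p(1), of D] by (simp add: j algebra_simps)
  then have "int p dvd D ^ j - 1" using p by (simp add: prime_dvd_mult_iff)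
  then have "int p dvd (D ^ j - 1) * f (int p * x)" by (rule dvd_mult2)
  moreover have "int p dvd D ^ j * f (int p * x) - f x"
    using conv_power_prime[OF p(1), of n f "int p * x"] sum idempotent_conv_power[of j] j by simp
  ultimately have "int p dvd (D ^ j * f (int p * x) - f x) - (D ^ j - 1) * f (int p * x)"
    by (rule dvd_diff[rotated])
  then have "int p dvd f (int p * x) - f x" by (simp add: algebra_simps)
  moreover have "\<bar>f (int p * x) - f x\<bar> < int p"
    using bound[of x] bound[of "int p * x"] by linarith
  ultimately show ?thesis
    using dvd_imp_le_int[of "f (int p * x) - f x" "int p"] by force
qed

text \<open>Every unit modulo \<open>n\<close> is represented by a product of large primes.\<close>

lemma idempotent_unit_mult:
  assumes u: "coprime u (int n)"
  shows "f (u * x) = f x"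
proof -
  \<comment> \<open>Every prime above \<open>B\<close> meets the hypotheses of
    \<open>idempotent_prime_mult\<close>: it exceeds \<open>n\<close>, \<open>D\<close> and twice
    every absolute value of \<open>f\<close>.\<close>
  define B where "B = n + nat D + 2 * nat (\<Sum>i<n. \<bar>f (int i)\<bar>)"
  have bound: "2 * \<bar>f y\<bar> \<le> int B" for y
  proof -
    let ?r = "nat (y mod int n)"
    have r: "int n dvd y - int ?r" "?r < n"
      using n by (simp_all add: minus_mod_eq_mult_div nat_less_iff)
    have "\<bar>f (int ?r)\<bar> \<le> (\<Sum>i<n. \<bar>f (int i)\<bar>)"
      by (rule member_le_sum[of ?r "{..<n}" "\<lambda>i. \<bar>f (int i)\<bar>"]) (use r in auto)
    then show ?thesis using per[OF r(1)] by (simp add: B_def)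
  qed
  have *: "f (int v * x) = f x" if "\<And>q. prime q \<Longrightarrow> q dvd v \<Longrightarrow> q > B" "v > 0" for v x
    using that
  proof (induction v arbitrary: x rule: prime_divisors_induct)
    case (factor p v)
    then have "p > B" by simp
    then have "\<not> p dvd n" "\<not> int p dvd D"
      using n D by (auto simp: B_def dest!: dvd_imp_le zdvd_imp_le)
    moreover have "2 * \<bar>f y\<bar> < int p" for y
      using bound[of y] \<open>p > B\<close> by linarith
    ultimately have "f (int p * (int v * x)) = f (int v * x)"
      using factor.hyps by (intro idempotent_prime_mult)
    also have "\<dots> = f x" using factor.prems by (intro factor.IH) auto
    finally show ?case by (simp add: mult.assoc)
  qed auto
  \<comment> \<open>A shift by a multiple of \<open>n\<close> removes all prime factors up to
    \<open>B\<close>; adding \<open>X\<close>, a multiple of both \<open>n\<close> and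
    \<open>fact B\<close>, then makes the number positive.\<close>
  obtain t where t: "coprime (u + int n * t) (fact B)"
    using coprime_add_mult_exists[OF u, of "fact B"] by auto
  define w where "w = u + int n * t"
  define X where "X = int n * fact B * (\<bar>w\<bar> + 1)"
  define v where "v = w + X"
  have "1 * 1 * (\<bar>w\<bar> + 1) \<le> X"
    unfolding X_def by (intro mult_mono) (use n in \<open>auto simp: fact_ge_1\<close>)
  then have v: "v > 0" unfolding v_def using abs_ge_minus_self[of w] by simp
  have "coprime v (fact B)"
  proof -
    have "v = w + fact B * (int n * (\<bar>w\<bar> + 1))" by (simp add: v_def X_def)
    then have "gcd v (fact B) = gcd w (fact B)" by (metis add.commute gcd.commute gcd_add_mult mult.commute)
    then show ?thesis using t by (simp add: w_def coprime_iff_gcd_eq_1)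
  qed
  then have cop: "coprime (nat v) (fact B)"
    using v by (metis coprime_int_iff int_nat_eq of_nat_fact order_less_imp_le)
  have "f (int (nat v) * x) = f x"
  proof (rule *)
    fix q assume q: "prime q" "q dvd nat v"
    show "q > B"
    proof (rule ccontr)
      assume "\<not> q > B"
      then have "q dvd fact B" using q(1) by (simp add: prime_dvd_fact_iff)
      then have "is_unit q" using coprime_common_divisor[OF cop q(2)] by blast
      then show False using q(1) not_prime_unit by blast
    qed
  qed (use v in simp)
  moreover have "int n dvd int (nat v) * x - u * x"
  proof -
    have "int (nat v) * x - u * x = int n * ((t + fact B * (\<bar>w\<bar> + 1)) * x)"
      using v by (simp add: v_def X_def w_def algebra_simps)
    then show ?thesis by simp
  qed
  ultimately show ?thesis using per by metis
qed

end

section \<open>Roots modulo the order of a subgroup\<close>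

text \<open>Only the \<open>p\<close>-part of the gcd can change, and it grows exactly when
  \<open>z\<close> contains the full power \<open>p ^ Suc c\<close>.\<close>

lemma gcd_prime_power_mult:
  fixes p s z :: int
  assumes p: "prime p" "\<not> p dvd s"
  shows "gcd z (p ^ Suc c * s) = (if p ^ Suc c dvd z then p else 1) * gcd z (p ^ c * s)"
proof -
  have p0: "p > 0" using p(1) by (simp add: prime_gt_0_int)
  have cop: "coprime p s" using p by (simp add: prime_imp_coprime)
  show ?thesis
  proof (cases "p ^ Suc c dvd z")
    case True
    then obtain w where w: "z = p ^ Suc c * w" ..
    have "gcd z (p ^ Suc c * s) = p ^ Suc c * gcd w s"
      using p0 by (simp add: w gcd_mult_distrib_int[symmetric] abs_mult)
    moreover have "gcd z (p ^ c * s) = p ^ c * gcd (p * w) s"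
    proof -
      have "z = p ^ c * (p * w)" by (simp add: w)
      then show ?thesis using p0 by (simp only: gcd_mult_distrib_int[symmetric]) simp
    qed
    moreover have "gcd (p * w) s = gcd w s"
      using cop by (simp add: gcd_mult_left_left_cancel coprime_commute)
    ultimately show ?thesis using True by simp
  next
    case False
    then have "z \<noteq> 0" by auto
    then obtain w where w: "z = p ^ multiplicity p z * w" "\<not> p dvd w"
      using multiplicity_decompose'[of z p] p(1) not_prime_unit by blast
    define j where "j = multiplicity p z"
    have j: "j \<le> c"
    proof (rule ccontr)
      assume "\<not> j \<le> c"
      then have "p ^ Suc c dvd p ^ j" by (intro le_imp_power_dvd) simp
      then show False using False w(1) by (metis dvd_mult2 j_def)
    qed
    \<comment> \<open>Powers of \<open>p\<close> beyond the exact exponent \<open>j\<close> of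
      \<open>z\<close> do not affect the gcd. The instances used are \<open>i = Suc c - j\<close>
      and \<open>i = c - j\<close>.\<close>
    have *: "gcd z (p ^ (j + i) * s) = p ^ j * gcd w s" for i
    proof -
      have "coprime w (p ^ i)" using p(1) w(2) by (meson coprime_commute coprime_power_right_iff prime_imp_coprime)
      then have "gcd w (p ^ i * s) = gcd w s"
        by (simp add: gcd_mult_right_left_cancel)
      moreover have "gcd z (p ^ (j + i) * s) = p ^ j * gcd w (p ^ i * s)"
      proof -
        have "p ^ (j + i) * s = p ^ j * (p ^ i * s)" by (simp add: power_add)
        moreover have "z = p ^ j * w" using w(1) by (simp add: j_def)
        ultimately show ?thesis using p0 by (simp only: gcd_mult_distrib_int[symmetric]) simp
      qed
      ultimately show ?thesis by simp
    qed
    show ?thesis using False *[of "Suc c - j"] *[of "c - j"] j by (simp del: power_Suc)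
  qed
qed

text \<open>The multiples of \<open>k\<close> and of \<open>m\<close> are the \<open>N\<close> and
  \<open>N'\<close> of the overview, and \<open>q\<close> is the full power of \<open>p\<close> in
  \<open>k\<close>. The hypothesis on \<open>A\<close> says that elements generating the same
  subgroup modulo \<open>k\<close> are not separated.\<close>

context
  fixes p c s :: nat and A :: "int \<Rightarrow> bool" and m k q :: nat
  assumes p: "prime p" "\<not> p dvd s"
    and A: "\<And>z z'. gcd z (int k) = gcd z' (int k) \<Longrightarrow> A z = A z'"
    and m: "m = p ^ c * s" and k: "k = p * m" and q: "q = p ^ Suc c"
begin

lemma gcd_top_multiple: "gcd z (int k) = (if int q dvd z then int p else 1) * gcd z (int m)"
proof -
  have "prime (int p)" "\<not> int p dvd int s" using p by auto
  from gcd_prime_power_mult[OF this, of z c] show ?thesis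
    by (simp add: m k q mult.assoc)
qed

text \<open>On a coset of the multiples of \<open>m\<close> the gcd with \<open>m\<close> is
  constant, so \<open>A\<close> takes at most two values there: one on the multiples of
  \<open>q\<close>, one elsewhere.\<close>

lemma mem_cong_gcd:
  assumes "gcd z (int m) = gcd z' (int m)" "int q dvd z \<longleftrightarrow> int q dvd z'"
  shows "A z = A z'"
  by (rule A) (use assms in \<open>simp add: gcd_top_multiple\<close>)

lemma mem_period:
  assumes "int k dvd z - z'"
  shows "A z = A z'"
proof -
  obtain t where "z - z' = int k * t" using assms ..
  then have "z = z' + int k * t" by simp
  then have "gcd z (int k) = gcd z' (int k)"
    by (metis gcd.commute gcd_add_mult add.commute mult.commute)
  then show ?thesis by (rule A)
qed

lemma gcd_add_mult_m: "gcd (z + l * int m) (int m) = gcd z (int m)"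
  by (metis gcd.commute gcd_add_mult add.commute)

lemma factors_pos: "p > 0" "s > 0" "m > 0"
  using p by (auto simp: m prime_gt_0_nat intro!: Nat.gr0I)

lemma q_dvd_k: "int q dvd int k"
  by (simp add: k q m)

lemma not_q_dvd_mult_m:
  assumes "\<not> int p dvd l"
  shows "\<not> int q dvd l * int m"
proof
  assume "int q dvd l * int m"
  then have "int p ^ c * int p dvd int p ^ c * (l * int s)"
    by (simp add: q m algebra_simps)
  then have "int p dvd l * int s" using factors_pos by simp
  then show False using p assms by (simp add: prime_dvd_mult_iff)
qed

lemma not_q_dvd_m: "\<not> int q dvd int m"
proof -
  have "\<not> int p dvd 1" using p(1) not_prime_unit[of "int p"] by auto
  from not_q_dvd_mult_m[OF this] show ?thesis by simp
qed

text \<open>Here \<open>p ^ c\<close> divides \<open>x\<close>. After cancelling it, a congruence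
  modulo \<open>p\<close> remains, solvable because \<open>s\<close> is invertible modulo
  \<open>p\<close>.\<close>

lemma exists_translate:
  assumes "int q dvd int p * x"
  shows "\<exists>l. int q dvd x + l * int m"
proof -
  have "int p * int p ^ c dvd int p * x" using assms by (simp add: q)
  then have "int p ^ c dvd x" using factors_pos by simp
  then obtain w where w: "x = int p ^ c * w" ..
  have "coprime (int s) (int p)" using p by (metis coprime_commute coprime_int_iff prime_imp_coprime)
  then obtain v u where "v * int s + u * int p = 1"
    using bezout_int[of "int s" "int p"] by auto
  then have "int s * v - 1 = int p * (- u)" by (simp add: algebra_simps)
  then have "int p dvd int s * v - 1" by simp
  then have "int p dvd (int s * v - 1) * (- w)" by (rule dvd_mult2)
  then have "int p dvd w + (- (w * v)) * int s" by (simp add: algebra_simps)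
  then have "int p ^ c * int p dvd int p ^ c * (w + (- (w * v)) * int s)" by (intro mult_dvd_mono) auto
  then have "int q dvd x + (- (w * v)) * int m" by (simp add: q w m algebra_simps)
  then show ?thesis ..
qed

text \<open>The sum counts the elements of \<open>A\<close> modulo \<open>k\<close> in one coset of
  the multiples of \<open>m\<close>; another representative only permutes the summands.\<close>

lemma translate_sum_cong:
  assumes "int m dvd x - x'"
  shows "(\<Sum>l<p. of_bool (A (x + int l * int m))) = (\<Sum>l<p. of_bool (A (x' + int l * int m)) :: int)"
proof -
  obtain t where "x - x' = int m * t" using assms ..
  then have x: "x = x' + t * int m" by (simp add: algebra_simps)
  have "(\<Sum>l<p. of_bool (A (x' + (int l + t) * int m)) :: int)
      = (\<Sum>l<p. of_bool (A (x' + int l * int m)))"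
  proof (rule sum_mod_period[of p "\<lambda>l. of_bool (A (x' + l * int m))" "\<lambda>l. l + t"])
    fix i j :: int assume "int p dvd i - j"
    then have "int p * int m dvd (i - j) * int m" by (intro mult_dvd_mono) auto
    then have "int k dvd (x' + i * int m) - (x' + j * int m)" by (simp add: k algebra_simps)
    from mem_period[OF this]
    show "of_bool (A (x' + i * int m)) = (of_bool (A (x' + j * int m)) :: int)" by simp
  qed (use factors_pos in auto)
  then show ?thesis by (simp add: x algebra_simps)
qed

text \<open>The congruence \<open>p * i = p * x\<close> modulo \<open>k\<close> means
  \<open>i = x\<close> modulo \<open>m\<close>, so the roots are the \<open>p\<close> residues
  modulo \<open>k\<close> in the coset of \<open>x\<close>.\<close>

lemma root_count:
  "(\<Sum>i<k. of_bool (A (int i)) * of_bool (int k dvd int p * x - int (p * i)))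
    = (\<Sum>l<p. of_bool (A (x + int l * int m)) :: int)"
proof -
  have dvd: "int k dvd int p * x - int (p * i) \<longleftrightarrow> int m dvd x - int i" for i
    using factors_pos by (simp add: k flip: right_diff_distrib)
  let ?F = "\<lambda>i. of_bool (A (int i)) * of_bool (int m dvd x - int i) :: int"
  have "(\<Sum>i<k. ?F i) = (\<Sum>l<p. \<Sum>i\<in>{l * m..<l * m + m}. ?F i)"
    unfolding k by (rule sum.nat_group[symmetric])
  also have "\<dots> = (\<Sum>l<p. \<Sum>i<m. of_bool (A (int i + int l * int m)) * of_bool (int m dvd x - int i))"
  proof (rule sum.cong[OF refl])
    fix l
    have "(\<Sum>i\<in>{l * m..<l * m + m}. ?F i) = (\<Sum>i\<in>{0..<m}. ?F (i + l * m))"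
      using sum.shift_bounds_nat_ivl[of ?F 0 "l * m" m] by (simp add: add.commute)
    also have "\<dots> = (\<Sum>i<m. of_bool (A (int i + int l * int m)) * of_bool (int m dvd x - int i))"
    proof (rule sum.cong)
      fix i
      have "int m dvd x - int (i + l * m) \<longleftrightarrow> int m dvd x - int i"
        using dvd_add_left_iff[of "int m" "- (int l * int m)" "x - int i"] by (simp add: algebra_simps)
      then show "?F (i + l * m) = of_bool (A (int i + int l * int m)) * of_bool (int m dvd x - int i)"
        by simp
    qed (auto simp: lessThan_atLeast0)
    finally show "(\<Sum>i\<in>{l * m..<l * m + m}. ?F i)
      = (\<Sum>i<m. of_bool (A (int i + int l * int m)) * of_bool (int m dvd x - int i))" .
  qed
  also have "\<dots> = (\<Sum>i<m. (\<Sum>l<p. of_bool (A (int i + int l * int m))) * of_bool (int m dvd x - int i))"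
    by (subst sum.swap) (simp only: sum_distrib_right)
  also have "\<dots> = (\<Sum>l<p. of_bool (A (x + int l * int m)))"
    by (rule sum_delta_mod[of m "\<lambda>x. \<Sum>l<p. of_bool (A (x + int l * int m))", OF factors_pos(3) translate_sum_cong])
  finally show ?thesis by (simp only: dvd)
qed

text \<open>A coset without multiples of \<open>q\<close> lies inside or outside \<open>A\<close>,
  giving the count \<open>p\<close> or \<open>0\<close>. Otherwise exactly one of its
  \<open>p\<close> residues is a multiple of \<open>q\<close>, and \<open>p\<close> divides the
  count iff \<open>A\<close> treats that residue like the others.\<close>

lemma prime_dvd_root_count_iff:
  "\<not> int p dvd (\<Sum>i<k. of_bool (A (int i)) * of_bool (int k dvd y - int (p * i)))
    \<longleftrightarrow> int q dvd y \<and> A y \<noteq> A (y + int m)"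
proof (cases "int p dvd y")
  case False
  \<comment> \<open>Since \<open>p\<close> divides \<open>k\<close>, roots exist only if
    \<open>p\<close> divides \<open>y\<close>.\<close>
  have "\<not> int k dvd y - int (p * i)" for i
  proof
    assume "int k dvd y - int (p * i)"
    then have "int p dvd y - int p * int i" by (simp add: k dvd_mult_left)
    then have "int p dvd y" by (simp add: dvd_diff_left_iff)
    then show False using False by simp
  qed
  moreover have "\<not> int q dvd y" using False by (auto simp: q dest: dvd_mult_left)
  ultimately show ?thesis by simp
next
  case True
  then obtain x where y: "y = int p * x" ..
  show ?thesis
  proof (cases "\<exists>l. int q dvd x + l * int m")
    case False
    then have "A (x + l * int m) = A x" for l
      using False[THEN not_ex[THEN iffD1], rule_format, of 0]
      by (intro mem_cong_gcd gcd_add_mult_m) auto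
    then have "int p dvd (\<Sum>l<p. of_bool (A (x + int l * int m)))" by simp
    moreover have "\<not> int q dvd y" using False exists_translate y by blast
    ultimately show ?thesis using root_count[of x] y by simp
  next
    case True
    then obtain l where l: "int q dvd x + l * int m" ..
    define x0 where "x0 = x + l * int m"
    have x0: "int q dvd x0" using l by (simp add: x0_def)
    have "(\<Sum>i<k. of_bool (A (int i)) * of_bool (int k dvd y - int (p * i)))
        = (\<Sum>l<p. of_bool (A (x0 + int l * int m)) :: int)"
      unfolding y root_count by (rule translate_sum_cong) (simp add: x0_def)
    \<comment> \<open>Within this range only \<open>l = 0\<close> gives a multiple of
      \<open>q\<close>.\<close>
    also have "{..<p} = insert 0 {1..<p}" using factors_pos by auto
    also have "(\<Sum>l\<in>\<dots>. of_bool (A (x0 + int l * int m)) :: int)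
        = of_bool (A x0) + (\<Sum>l\<in>{1..<p}. of_bool (A (x0 + int m)))"
    proof -
      have "A (x0 + int l * int m) = A (x0 + int m)" if "l \<in> {1..<p}" for l
      proof (rule mem_cong_gcd)
        have "\<not> int p dvd int l" using that by (auto dest: dvd_imp_le)
        then have "\<not> int q dvd int l * int m" by (rule not_q_dvd_mult_m)
        then show "int q dvd x0 + int l * int m \<longleftrightarrow> int q dvd x0 + int m"
          using x0 not_q_dvd_m by (simp add: dvd_add_right_iff)
        show "gcd (x0 + int l * int m) (int m) = gcd (x0 + int m) (int m)"
          using gcd_add_mult_m[of x0 "int l"] gcd_add_mult_m[of x0 1] by simp
      qed
      then have "(\<Sum>l\<in>{1..<p}. of_bool (A (x0 + int l * int m)) :: int)
          = (\<Sum>l\<in>{1..<p}. of_bool (A (x0 + int m)))"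
        by (intro sum.cong) auto
      then show ?thesis by simp
    qed
    finally have sum: "(\<Sum>i<k. of_bool (A (int i)) * of_bool (int k dvd y - int (p * i)))
        = of_bool (A x0) + int (p - 1) * of_bool (A (x0 + int m))" by simp
    \<comment> \<open>The count concerns \<open>x0\<close>, the claim \<open>y\<close>. Modulo
      \<open>k\<close>, \<open>y\<close> is \<open>p * x0\<close>, and multiplication by
      \<open>p\<close> keeps the gcd with \<open>m\<close> because \<open>x0\<close> already
      contains the full power of \<open>p\<close>.\<close>
    have yx: "y = int p * x0 - l * int k" by (simp add: y x0_def k algebra_simps)
    have qy: "int q dvd y" unfolding yx using x0 q_dvd_k by simp
    have gcd: "gcd (int p * x0) (int m) = gcd x0 (int m)"
    proof -
      obtain w where "x0 = int q * w" using x0 ..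
      then have w: "x0 = int p ^ c * (int p * w)" by (simp add: q)
      have cop: "coprime (int p) (int s)"
        using p by (metis coprime_int_iff prime_imp_coprime)
      have e: "int p * x0 = int p ^ c * (int p * (int p * w))" "int m = int p ^ c * int s"
        by (simp_all add: w m mult_ac)
      have "gcd (int p * v) (int s) = gcd v (int s)" for v
        using cop by (simp add: gcd_mult_left_left_cancel coprime_commute)
      then show ?thesis unfolding e unfolding w by (simp only: gcd_mult_distrib_int[symmetric])
    qed
    have "A y = A (int p * x0)"
      by (rule mem_period) (simp add: yx)
    also have "\<dots> = A x0"
      by (rule mem_cong_gcd) (use gcd x0 in auto)
    finally have Ay: "A y = A x0" .
    have "A (y + int m) = A (int p * x0 + int m)"
      by (rule mem_period) (simp add: yx)
    also have "\<dots> = A (x0 + int m)"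
      by (rule mem_cong_gcd)
        (use gcd x0 not_q_dvd_m gcd_add_mult_m[of _ 1] in \<open>auto simp: dvd_add_right_iff\<close>)
    finally have Aym: "A (y + int m) = A (x0 + int m)" .
    \<comment> \<open>The possible counts are \<open>0\<close>, \<open>1\<close>,
      \<open>p - 1\<close> and \<open>p\<close>; the middle two are not divisible by
      \<open>p\<close>, even if \<open>p = 2\<close>.\<close>
    have "p \<ge> 2" using p(1) by (rule prime_ge_2_nat)
    then have "\<not> int p dvd 1" "\<not> int p dvd int (p - 1)"
      by (auto simp: zdvd_not_zless simp del: of_nat_diff dest!: dvd_imp_le)
    moreover have "1 + int (p - 1) = int p" using factors_pos by simp
    ultimately show ?thesis
      unfolding sum by (auto simp: Ay Aym qy simp del: of_nat_diff)
  qed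
qed

text \<open>By \<open>disj\<close>, a coset that only partly lies in \<open>A\<close> misses exactly
  its multiples of \<open>q\<close>. Adding these fills the coset.\<close>

lemma union_partial_cosets_stable:
  assumes disj: "\<And>z. A z \<Longrightarrow> \<not> (int q dvd z \<and> A z \<noteq> A (z + int m))"
    and y: "A y \<or> int q dvd y \<and> A y \<noteq> A (y + int m)"
  shows "A (y + int m) \<or> int q dvd y + int m \<and> A (y + int m) \<noteq> A (y + int m + int m)"
proof (cases "A (y + int m)")
  case False
  then have "A y" using y by blast
  then have "\<not> int q dvd y" using disj[of y] False by blast
  have gcd: "gcd (z + int m) (int m) = gcd z (int m)" for z
    using gcd_add_mult_m[of z 1] by simp
  have q1: "int q dvd y + int m"
  proof (rule ccontr)
    assume "\<not> int q dvd y + int m"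
    then have "A (y + int m) = A y"
      using \<open>\<not> int q dvd y\<close> by (intro mem_cong_gcd gcd) simp
    then show False using \<open>A y\<close> False by simp
  qed
  then have "\<not> int q dvd y + int m + int m"
    using not_q_dvd_m by (simp only: dvd_add_right_iff) simp
  then have "A (y + int m + int m) = A y"
    using \<open>\<not> int q dvd y\<close> by (intro mem_cong_gcd) (simp_all only: gcd)
  then show ?thesis using q1 \<open>A y\<close> False by simp
qed simp

end

section \<open>Rational Schur rings\<close>

text \<open>Division with remainder by the least positive element; \<open>n\<close> guarantees that
  there is one.\<close>

lemma int_subgroup_multiples:
  fixes S :: "int \<Rightarrow> bool"
  assumes n: "n > 0" "S (int n)"
    and add: "\<And>i j. S i \<Longrightarrow> S j \<Longrightarrow> S (i + j)" and neg: "\<And>i. S i \<Longrightarrow> S (- i)"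
  shows "\<exists>k::nat. k > 0 \<and> (\<forall>i. S i \<longleftrightarrow> int k dvd i)"
proof -
  define k where "k = (LEAST k. k > 0 \<and> S (int k))"
  have k: "k > 0" "S (int k)"
    using LeastI[of "\<lambda>k. k > 0 \<and> S (int k)" n] n by (auto simp: k_def)
  have zero: "S 0" using add[OF n(2) neg[OF n(2)]] by simp
  have nat: "S (int j * int k)" for j
    by (induction j) (auto simp: zero algebra_simps intro: add k)
  have mult: "S (t * int k)" for t
  proof (cases "t \<ge> 0")
    case True
    then show ?thesis using nat[of "nat t"] by simp
  next
    case False
    then show ?thesis using neg[OF nat[of "nat (- t)"]] by simp
  qed
  have "int k dvd i" if "S i" for i
  proof (rule ccontr)
    assume "\<not> int k dvd i"
    then have "i mod int k \<noteq> 0" by auto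
    moreover have "i mod int k \<ge> 0" "i mod int k < int k" using k by simp_all
    ultimately have "0 < nat (i mod int k)" "nat (i mod int k) < k" by linarith+
    moreover have "S (i + (- (i div int k)) * int k)" using that mult by (intro add)
    then have "S (i mod int k)" by (simp add: minus_div_mult_eq_mod)
    ultimately show False
      using not_less_Least[of "nat (i mod int k)" "\<lambda>k. k > 0 \<and> S (int k)"] by (simp add: k_def)
  qed
  moreover have "S i" if "int k dvd i" for i
  proof -
    from that obtain t where "i = int k * t" ..
    then show ?thesis using mult[of t] by (simp add: mult.commute)
  qed
  ultimately show ?thesis using k by blast
qed

text \<open>A rational Schur ring over the cyclic group of order \<open>n\<close>, given by the equivalence relation
  whose classes are the (preimages in the integers of the) basic sets.\<close>

locale rational_schur_relation =
  fixes n :: nat and r :: "int \<Rightarrow> int \<Rightarrow> bool"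
  assumes n_pos: "n > 0"
    and equivp_r: "equivp r"
    and r_zero: "\<And>i. r 0 i \<Longrightarrow> int n dvd i"
    and r_mod: "\<And>i j. int n dvd i - j \<Longrightarrow> r i j"
    and r_unit: "\<And>u i. coprime u (int n) \<Longrightarrow> r i (u * i)"
    and r_conv: "\<And>f g i j. (\<And>i j. r i j \<Longrightarrow> f i = f j) \<Longrightarrow> (\<And>i j. r i j \<Longrightarrow> g i = g j) \<Longrightarrow>
      r i j \<Longrightarrow> conv n f g i = conv n f g j"
begin

text \<open>For integer values these are the integral elements of the Schur ring, for predicates the
  unions of basic sets.\<close>

definition resp :: "(int \<Rightarrow> 'v) \<Rightarrow> bool" where
  "resp f \<longleftrightarrow> (\<forall>i j. r i j \<longrightarrow> f i = f j)"

section \<open>Closure properties of functions constant on the classes\<close>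

lemma resp_comp: "resp f \<Longrightarrow> resp (\<lambda>i. h (f i))"
  unfolding resp_def by metis

lemma resp_comp2: "resp f \<Longrightarrow> resp g \<Longrightarrow> resp (\<lambda>i. h (f i) (g i))"
  unfolding resp_def by metis

lemma resp_mod: "resp f \<Longrightarrow> int n dvd i - j \<Longrightarrow> f i = f j"
  using r_mod unfolding resp_def by blast

lemma resp_neg: "resp f \<Longrightarrow> f (- i) = f i"
  using r_unit[of "-1" i] unfolding resp_def by simp

lemma resp_class: "resp (r x)"
  using equivp_r unfolding resp_def by (meson equivp_symp equivp_transp)

lemma resp_interior: "resp (\<lambda>y. \<forall>z. r y z \<longrightarrow> A z)"
  using equivp_r unfolding resp_def by (meson equivp_symp equivp_transp)

lemma resp_conv: "resp f \<Longrightarrow> resp g \<Longrightarrow> resp (conv n f g)"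
  using r_conv[of f g] unfolding resp_def by blast

text \<open>The sumset is the support of the convolution of the two indicators, which counts
  representations modulo \<open>n\<close>.\<close>

lemma resp_sumset:
  assumes A: "resp A" and B: "resp B"
  shows "resp (\<lambda>y. \<exists>t. A t \<and> B (y - t))"
proof -
  have "(\<exists>t. A t \<and> B (y - t)) \<longleftrightarrow> conv n (\<lambda>i. of_bool (A i)) (\<lambda>i. of_bool (B i)) y \<noteq> 0" for y
  proof -
    have "(\<exists>t. A t \<and> B (y - t)) \<longleftrightarrow> (\<exists>i<n. A (int i) \<and> B (y - int i))"
    proof safe
      fix t assume t: "A t" "B (y - t)"
      let ?i = "nat (t mod int n)"
      have i: "int n dvd t - int ?i" "?i < n"
        using n_pos by (simp_all add: minus_mod_eq_mult_div nat_less_iff)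
      have "A (int ?i)" using resp_mod[OF A i(1)] t by simp
      moreover have "int n dvd (y - int ?i) - (y - t)" using i(1) by simp
      then have "B (y - int ?i)" using resp_mod[OF B] t by blast
      ultimately show "\<exists>i<n. A (int i) \<and> B (y - int i)" using i(2) by blast
    qed blast
    also have "\<dots> \<longleftrightarrow> conv n (\<lambda>i. of_bool (A i)) (\<lambda>i. of_bool (B i)) y \<noteq> 0"
      unfolding conv_def by (subst sum_nonneg_eq_0_iff) auto
    finally show ?thesis .
  qed
  then show ?thesis
    using resp_comp[OF resp_conv[OF resp_comp[OF A, of of_bool] resp_comp[OF B, of of_bool]],
        of "\<lambda>v. v \<noteq> 0"] by simp
qed

text \<open>As \<open>-1\<close> is a unit, \<open>E\<close> is symmetric, so the stabilizer is the
  complement of the sumset of \<open>E\<close> and its complement.\<close>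

lemma resp_stabilizer:
  assumes E: "resp E"
  shows "resp (\<lambda>t. \<forall>y. E y \<longrightarrow> E (y + t))"
proof -
  have "resp (\<lambda>t. \<not> (\<exists>y. E y \<and> \<not> E (t - y)))"
    by (rule resp_comp[OF resp_sumset[OF E resp_comp[OF E]]])
  moreover have "(\<lambda>t. \<not> (\<exists>y. E y \<and> \<not> E (t - y))) = (\<lambda>t. \<forall>y. E y \<longrightarrow> E (y + t))"
  proof
    fix t
    have neg: "E (- y) = E y" for y by (rule resp_neg[OF E])
    show "(\<not> (\<exists>y. E y \<and> \<not> E (t - y))) = (\<forall>y. E y \<longrightarrow> E (y + t))"
    proof (intro iffI allI impI notI)
      fix y assume *: "\<not> (\<exists>y. E y \<and> \<not> E (t - y))" "E y"
      then have "E (t - (- y))" using neg by blast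
      then show "E (y + t)" by (simp add: add.commute)
    next
      assume *: "\<forall>y. E y \<longrightarrow> E (y + t)" "\<exists>y. E y \<and> \<not> E (t - y)"
      then obtain y where y: "E y" "\<not> E (t - y)" by blast
      then have "E (- y + t)" using neg * by blast
      then show False using y by simp
    qed
  qed
  ultimately show ?thesis by simp
qed

text \<open>Modulo \<open>k\<close>, \<open>i\<close> is a unit multiple of its gcd with
  \<open>k\<close>, and that unit lifts to one modulo \<open>n\<close>.\<close>

lemma resp_gcd:
  assumes f: "resp f" and k: "k > 0" and per: "\<And>i j. int k dvd i - j \<Longrightarrow> f i = f j"
  shows "f (gcd i (int k)) = f i"
proof -
  define e where "e = gcd i (int k)"
  obtain i' k' where ik: "i = e * i'" "int k = e * k'"
    unfolding e_def by (meson dvdE gcd_dvd1 gcd_dvd2)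
  have "e \<noteq> 0" using k by (simp add: e_def)
  then have "coprime i' k'"
    using ik unfolding e_def by (metis gcd_coprime mult.commute)
  then obtain t where t: "coprime (i' + k' * t) (int n)"
    using coprime_add_mult_exists[of i' k' "int n"] n_pos by auto
  have "f e = f ((i' + k' * t) * e)"
    using r_unit[OF t, of e] f unfolding resp_def by blast
  also have "\<dots> = f i"
    by (rule per) (simp add: ik algebra_simps)
  finally show ?thesis by (simp add: e_def)
qed

text \<open>For \<open>k\<close>-periodic functions convolution modulo \<open>n\<close> is
  \<open>n / k\<close> times convolution modulo \<open>k\<close>, so an exact division transfers
  invariance.\<close>

lemma resp_conv_period:
  assumes k: "k > 0" "k dvd n" and f: "resp f" and g: "resp g"
    and perf: "\<And>i j. int k dvd i - j \<Longrightarrow> f i = f j" and perg: "\<And>i j. int k dvd i - j \<Longrightarrow> g i = g j"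
  shows "resp (conv k f g)"
proof -
  obtain l where l: "n = l * k" using k(2) by (metis dvdE mult.commute)
  have "conv n f g y = int l * conv k f g y" for y
    unfolding conv_def l
  proof (rule sum_multiple_period)
    fix i
    have "f (i + int k) = f i" by (rule perf) simp
    moreover have "g (y - (i + int k)) = g (y - i)" by (rule perg) simp
    ultimately show "f (i + int k) * g (y - (i + int k)) = f i * g (y - i)" by simp
  qed
  then have "conv k f g = (\<lambda>y. conv n f g y div int l)" using l n_pos by auto
  then show ?thesis using resp_comp[OF resp_conv[OF f g], of "\<lambda>v. v div int l"] by simp
qed

text \<open>Periodicity is part of the induction since \<open>resp_conv_period\<close> needs it; the
  base case is the indicator of the subgroup itself.\<close>

lemma resp_conv_power:
  assumes k: "k > 0" "k dvd n" "resp (\<lambda>i. int k dvd i)" and f: "resp f"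
    and per: "\<And>i j. int k dvd i - j \<Longrightarrow> f i = f j"
  shows "resp (conv_power k f j) \<and> (\<forall>y z. int k dvd y - z \<longrightarrow> conv_power k f j y = conv_power k f j z)"
proof (induction j)
  case 0
  have "conv_power k f 0 y = conv_power k f 0 z" if "int k dvd y - z" for y z
  proof -
    have "int k dvd y \<longleftrightarrow> int k dvd z" using dvd_add_right_iff[OF that, of z] by simp
    then show ?thesis by simp
  qed
  moreover have "resp (conv_power k f 0)" using resp_comp[OF k(3), of of_bool] by simp
  ultimately show ?case by blast
next
  case (Suc j)
  have "conv_power k f (Suc j) y = conv_power k f (Suc j) z" if "int k dvd y - z" for y z
    unfolding conv_power.simps conv_def
  proof (rule sum.cong[OF refl])
    fix i
    have "int k dvd (y - int i) - (z - int i)" using that by simp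
    then have "conv_power k f j (y - int i) = conv_power k f j (z - int i)" using Suc by blast
    then show "f (int i) * conv_power k f j (y - int i) = f (int i) * conv_power k f j (z - int i)"
      by simp
  qed
  moreover have "resp (conv_power k f (Suc j))"
    unfolding conv_power.simps using Suc per by (intro resp_conv_period k f) blast+
  ultimately show ?case by blast
qed

lemma r_refl: "r x x"
  using equivp_r by (rule equivp_reflp)

lemma resp_order: "resp (\<lambda>i. int n dvd i)"
proof -
  have "int n dvd j" if "r i j" "int n dvd i" for i j
  proof -
    have "r 0 i" using that(2) by (intro r_mod) simp
    then have "r 0 j" using that(1) equivp_r by (meson equivp_transp)
    then show ?thesis by (rule r_zero)
  qed
  then show ?thesis unfolding resp_def using equivp_r by (meson equivp_symp)
qed

text \<open>The multiples of \<open>h\<close> form the smallest subgroup in the Schur ring that contains \<open>x\<close>.\<close>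

context
  fixes h :: nat and x :: int
  assumes h: "h > 0" "resp (\<lambda>i. int h dvd i)" "int h dvd x"
    and h_max: "\<And>k. k > 0 \<Longrightarrow> k dvd n \<Longrightarrow> resp (\<lambda>i. int k dvd i) \<Longrightarrow> int k dvd x \<Longrightarrow> k dvd h"
begin

lemma h_dvd_class: "r x t \<Longrightarrow> int h dvd t"
  using h(2,3) unfolding resp_def by blast

text \<open>The union \<open>B\<close> of all classes inside the multiples of \<open>q\<close> is a
  subgroup in the Schur ring containing \<open>x\<close>. By minimality it contains
  \<open>h\<close>.\<close>

lemma class_multiples_imp_dvd:
  assumes q: "\<And>t. r x t \<Longrightarrow> int q dvd t" "\<And>t. r 0 t \<Longrightarrow> int q dvd t"
  shows "q dvd h"
proof -
  define B where "B = (\<lambda>y. \<forall>z. r y z \<longrightarrow> int q dvd z)"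
  have B: "resp B" unfolding B_def by (rule resp_interior)
  have Bq: "int q dvd y" if "B y" for y using that r_refl unfolding B_def by blast
  have "\<exists>k::nat. k > 0 \<and> (\<forall>i. B i \<longleftrightarrow> int k dvd i)"
  proof (rule int_subgroup_multiples)
    show "n > 0" by (rule n_pos)
    have "B 0" using q(2) unfolding B_def by blast
    then show "B (int n)" using resp_mod[OF B, of "int n" 0] by simp
  next
    fix i j assume ij: "B i" "B j"
    show "B (i + j)"
      unfolding B_def
    proof (intro allI impI)
      fix z assume z: "r (i + j) z"
      \<comment> \<open>The sumset of \<open>B\<close> with itself is a union of classes, so the
        whole class of \<open>i + j\<close> consists of sums of two elements of
        \<open>B\<close>.\<close>
      have "resp (\<lambda>y. \<exists>t. B t \<and> B (y - t))" by (rule resp_sumset[OF B B])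
      moreover have "\<exists>t. B t \<and> B (i + j - t)" using ij by (intro exI[of _ i]) simp
      ultimately obtain t where "B t" "B (z - t)" using z unfolding resp_def by blast
      then have "int q dvd t + (z - t)" by (intro dvd_add Bq)
      then show "int q dvd z" by simp
    qed
  next
    fix i assume "B i"
    then show "B (- i)" using resp_neg[OF B] by blast
  qed
  then obtain k :: nat where k: "k > 0" "\<And>i. B i \<longleftrightarrow> int k dvd i" by blast
  have "B 0" using q(2) unfolding B_def by blast
  then have "B (int n)" using resp_mod[OF B, of "int n" 0] by simp
  moreover have "B x" using q(1) unfolding B_def by blast
  moreover have "B = (\<lambda>i. int k dvd i)" using k(2) by blast
  then have "resp (\<lambda>i. int k dvd i)" using B by simp
  ultimately have "k dvd h" using k by (intro h_max) auto
  then show ?thesis using k(2)[of "int h"] Bq[of "int h"] by simp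
qed

text \<open>The set of the \<open>y \<in> q\<int>\<close> with exactly one of \<open>y\<close>, \<open>y + m\<close> in \<open>A\<close> is invariant under the Schur
  relation because it is read off modulo \<open>p\<close> from the \<open>p\<close>-th convolution power of \<open>A\<close> (Wielandt).
  Adding it to \<open>A\<close> enlarges the stabilizer from \<open>k\<int>\<close> to a group containing \<open>m\<int>\<close> without
  adding the generator \<open>h\<close>.\<close>

lemma class_translate_step:
  assumes k: "k > 0" "k dvd n" "resp (\<lambda>i. int k dvd i)" and hk: "h dvd k" "k \<noteq> h"
    and IH: "\<And>k'. k' < k \<Longrightarrow> k' > 0 \<Longrightarrow> k' dvd n \<Longrightarrow> resp (\<lambda>i. int k' dvd i) \<Longrightarrow> h dvd k' \<Longrightarrow>
      \<exists>t. r x t \<and> int k' dvd int h - t"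
  shows "\<exists>t. r x t \<and> int k dvd int h - t"
proof -
  obtain l where l: "k = h * l" using hk(1) ..
  then have "l \<noteq> 1" using hk(2) by auto
  then obtain p where p: "prime p" "p dvd l" using prime_factor_nat by blast
  then obtain l' where l': "l = p * l'" by blast
  define m where "m = h * l'"
  have km: "k = p * m" by (simp add: l l' m_def)
  have p2: "p \<ge> 2" using p(1) by (rule prime_ge_2_nat)
  have m_pos: "m > 0" using km k(1) by (cases m) auto
  obtain s where s: "m = p ^ multiplicity p m * s" "\<not> p dvd s"
    using multiplicity_decompose'[of m p] m_pos p(1) not_prime_unit by blast
  define c where "c = multiplicity p m"
  have mc: "m = p ^ c * s" using s(1) by (simp add: c_def)
  define q where "q = p ^ Suc c"
  \<comment> \<open>\<open>h\<close> divides \<open>m\<close>, which contains one factor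
    \<open>p\<close> less than \<open>q\<close>.\<close>
  have not_qh: "\<not> q dvd h"
  proof
    assume "q dvd h"
    then have "q dvd m" by (simp add: m_def)
    then have "p ^ c * p dvd p ^ c * s" by (simp add: q_def mc mult.commute)
    then show False using s(2) p2 by simp
  qed
  define A where "A = (\<lambda>y. \<exists>t. r x t \<and> int k dvd y - t)"
  have A: "resp A" unfolding A_def by (rule resp_sumset[OF resp_class k(3)])
  have A_per: "A i = A j" if "int k dvd i - j" for i j
  proof -
    have "int k dvd i - t \<longleftrightarrow> int k dvd j - t" for t
      using dvd_add_right_iff[OF that, of "j - t"] by simp
    then show ?thesis by (simp add: A_def)
  qed
  have A_gcd: "A z = A z'" if "gcd z (int k) = gcd z' (int k)" for z z'
    using resp_gcd[OF A k(1) A_per, of z] resp_gcd[OF A k(1) A_per, of z'] that by simp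
  have A_x: "A t" if "r x t" for t
    unfolding A_def using that by (intro exI[of _ t]) simp
  have A_h: "int h dvd y" if "A y" for y
  proof -
    from that obtain t where t: "r x t" "int k dvd y - t" unfolding A_def by blast
    have "int h dvd int k" using hk(1) by simp
    then have "int h dvd (y - t) + t" using t h_dvd_class by (intro dvd_add) (auto intro: dvd_trans)
    then show ?thesis by simp
  qed
  define Q where "Q = (\<lambda>y. int q dvd y \<and> A y \<noteq> A (y + int m))"
  have Q: "resp Q"
  proof -
    let ?f = "\<lambda>i. (of_bool (A i) :: int)"
    have "Q = (\<lambda>y. \<not> int p dvd conv_power k ?f p y)"
    proof
      fix y
      let ?s = "\<Sum>i<k. ?f (int i) * of_bool (int k dvd y - int (p * i))"
      have "int p dvd conv_power k ?f p y - ?s" by (rule conv_power_prime[OF p(1)])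
      then have "int p dvd ?s \<longleftrightarrow> int p dvd conv_power k ?f p y"
        using dvd_add_right_iff[of "int p" "conv_power k ?f p y - ?s" ?s] by simp
      then show "Q y \<longleftrightarrow> \<not> int p dvd conv_power k ?f p y"
        using prime_dvd_root_count_iff[where A = A and y = y, OF p(1) s(2) A_gcd mc km q_def] unfolding Q_def by blast
    qed
    moreover have "resp (conv_power k ?f p)"
    proof -
      have "?f i = ?f j" if "int k dvd i - j" for i j using A_per[OF that] by simp
      then show ?thesis using resp_conv_power[OF k resp_comp[OF A, of of_bool]] by blast
    qed
    then have "resp (\<lambda>y. \<not> int p dvd conv_power k ?f p y)" by (rule resp_comp)
    ultimately show ?thesis by simp
  qed
  have q_k: "int q dvd int k" by (simp add: km q_def mc)
  \<comment> \<open>If \<open>A\<close> and \<open>Q\<close> met, periodicity modulo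
    \<open>k\<close> would give a common point in the class of \<open>x\<close>. The whole class
    would lie in \<open>Q\<close>, hence in the multiples of \<open>q\<close>, forcing
    \<open>q\<close> to divide \<open>h\<close>.\<close>
  have disj: "\<not> Q z" if "A z" for z
  proof
    assume "Q z"
    from \<open>A z\<close> obtain t where t: "r x t" "int k dvd z - t" unfolding A_def by blast
    have "A z = A t" using t(2) by (rule A_per)
    moreover have "A (z + int m) = A (t + int m)" using t(2) by (intro A_per) simp
    moreover have "int q dvd z - t" using q_k t(2) by (rule dvd_trans)
    then have "int q dvd z \<longleftrightarrow> int q dvd t"
      using dvd_add_right_iff[of "int q" "z - t" t] by simp
    ultimately have "Q t" using \<open>Q z\<close> unfolding Q_def by simp
    then have "Q x" using Q t(1) unfolding resp_def by blast
    then have "int q dvd t'" if "r x t'" for t'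
      using Q that unfolding resp_def Q_def by blast
    moreover have "int q dvd t'" if "r 0 t'" for t'
    proof -
      have "int k dvd 0 \<longleftrightarrow> int k dvd t'" using k(3) that unfolding resp_def by blast
      then have "int k dvd t'" by simp
      with q_k show ?thesis by (rule dvd_trans)
    qed
    ultimately have "q dvd h" by (rule class_multiples_imp_dvd)
    then show False using not_qh by blast
  qed
  define E where "E = (\<lambda>y. A y \<or> Q y)"
  have E: "resp E" unfolding E_def by (rule resp_comp2[OF A Q])
  have E_m: "E (y + int m)" if "E y" for y
    unfolding E_def Q_def
    by (rule union_partial_cosets_stable[where A = A, OF p(1) s(2) A_gcd mc km q_def])
      (use disj that in \<open>auto simp: E_def Q_def\<close>)
  have E_h: "int h dvd y" if "E y" for y
  proof (cases "A y")
    case True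
    then show ?thesis by (rule A_h)
  next
    case False
    \<comment> \<open>A point of \<open>Q\<close> outside \<open>A\<close> has its translate by
      \<open>m\<close> in \<open>A\<close>, and \<open>h\<close> divides \<open>m\<close>.\<close>
    then have "A (y + int m)" using that by (auto simp: E_def Q_def)
    then have "int h dvd y + int m" by (rule A_h)
    then show ?thesis using dvd_add_left_iff[of "int h" "int m" y] by (simp add: m_def)
  qed
  define N where "N = (\<lambda>t. \<forall>y. E y \<longrightarrow> E (y + t))"
  have N: "resp N" unfolding N_def by (rule resp_stabilizer[OF E])
  have N_n: "N (int n)"
  proof -
    have "E (y + int n) = E y" for y by (rule resp_mod[OF E]) simp
    then show ?thesis unfolding N_def by blast
  qed
  have "\<exists>k'::nat. k' > 0 \<and> (\<forall>i. N i \<longleftrightarrow> int k' dvd i)"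
  proof (rule int_subgroup_multiples[where S = N, OF n_pos N_n])
    fix i j assume ij: "N i" "N j"
    show "N (i + j)"
      unfolding N_def
    proof (intro allI impI)
      fix y assume "E y"
      then have "E (y + i + j)" using ij unfolding N_def by blast
      then show "E (y + (i + j))" by (simp add: add.assoc)
    qed
  next
    fix i assume "N i"
    then show "N (- i)" using resp_neg[OF N] by blast
  qed
  then obtain k' :: nat where k': "k' > 0" "\<And>i. N i \<longleftrightarrow> int k' dvd i" by blast
  have "N (int m)" using E_m unfolding N_def by blast
  then have "k' dvd m" using k'(2) by simp
  then have "k' \<le> m" using m_pos by (rule dvd_imp_le)
  also have "m < k" using km p2 m_pos by simp
  finally have "k' < k" .
  moreover have "k' dvd n" using N_n k'(2) by simp
  moreover have "N = (\<lambda>i. int k' dvd i)" using k'(2) by blast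
  then have "resp (\<lambda>i. int k' dvd i)" using N by simp
  moreover have "h dvd k'"
  proof -
    \<comment> \<open>Both \<open>x\<close> and \<open>x + k'\<close> lie in \<open>E\<close>, which
      consists of multiples of \<open>h\<close>.\<close>
    have "E x" unfolding E_def using A_x r_refl by blast
    moreover have "N (int k')" using k'(2) by simp
    ultimately have "int h dvd x + int k'" unfolding N_def using E_h by blast
    then show ?thesis using dvd_add_right_iff[OF h(3), of "int k'"] by simp
  qed
  ultimately obtain t where t: "r x t" "int k' dvd int h - t" using IH k'(1) by blast
  \<comment> \<open>The induction hypothesis puts \<open>h\<close> into \<open>E\<close>; not being
    a multiple of \<open>q\<close>, it lies in \<open>A\<close>.\<close>
  have "E (t + (int h - t))"
    using A_x[OF t(1)] t(2) k'(2) unfolding N_def E_def by blast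
  then have "A (int h)" using not_qh by (auto simp: E_def Q_def)
  then show ?thesis unfolding A_def .
qed

text \<open>Strong induction on \<open>k\<close>, where smaller \<open>k\<close> means a larger
  subgroup. It starts trivially at \<open>k = h\<close>; the case \<open>k = n\<close> gives the
  claim, as \<open>r\<close> absorbs congruence modulo \<open>n\<close>.\<close>

lemma class_contains_generator: "r x (int h)"
proof -
  have ex: "\<exists>t. r x t \<and> int k dvd int h - t"
    if "k > 0" "k dvd n" "resp (\<lambda>i. int k dvd i)" "h dvd k" for k
    using that
  proof (induction k rule: less_induct)
    case (less k)
    show ?case
    proof (cases "k = h")
      case True
      then show ?thesis using h(3) r_refl by (intro exI[of _ x]) simp
    next
      case False
      then show ?thesis
        by (rule class_translate_step[OF less.prems(1-4) _ less.IH])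
    qed
  qed
  have "h dvd n"
  proof -
    have "int h dvd int n + x"
      by (rule h_dvd_class) (rule r_mod, simp)
    then show ?thesis using h(3) by (simp add: dvd_add_left_iff)
  qed
  then obtain t where t: "r x t" "int n dvd int h - t"
    using ex[OF n_pos dvd_refl resp_order] by blast
  have "r t (int h)" using r_mod[OF t(2)] equivp_r by (meson equivp_symp)
  then show ?thesis using t(1) equivp_r by (meson equivp_transp)
qed

end

text \<open>The smallest subgroup in the Schur ring containing \<open>x\<close> is also the smallest
  one containing \<open>y\<close>, and both classes contain its generator \<open>h\<close>.\<close>

lemma subgroups_separate_classes:
  assumes xy: "\<And>h. h dvd n \<Longrightarrow> resp (\<lambda>i. int h dvd i) \<Longrightarrow> int h dvd x \<longleftrightarrow> int h dvd y"
  shows "r x y"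
proof -
  let ?H = "{h. h dvd n \<and> resp (\<lambda>i. int h dvd i) \<and> int h dvd x}"
  define h where "h = Max ?H"
  have fin: "finite ?H" using n_pos by (auto intro: finite_subset[of _ "{..n}"] dest: dvd_imp_le)
  have "1 \<in> ?H" by (simp add: resp_def)
  then have h: "h \<in> ?H" unfolding h_def using Max_in[OF fin] by blast
  then have h_pos: "h > 0" using n_pos by (auto intro!: Nat.gr0I)
  \<comment> \<open>Intersections of subgroups correspond to lcms, so the numerically largest member
    of \<open>?H\<close> is divisible by all others.\<close>
  have max: "k dvd h" if "k dvd n" "resp (\<lambda>i. int k dvd i)" "int k dvd x" for k
  proof -
    have "resp (\<lambda>i. int k dvd i \<and> int h dvd i)"
      using resp_comp2[OF that(2), of "\<lambda>i. int h dvd i" "(\<and>)"] h by blast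
    moreover have eq: "int (lcm k h) dvd i \<longleftrightarrow> int k dvd i \<and> int h dvd i" for i
      by (simp only: lcm_int_int_eq[symmetric] lcm_least_iff)
    ultimately have "resp (\<lambda>i. int (lcm k h) dvd i)" by (simp only: eq)
    moreover have "lcm k h dvd n" using that(1) h by simp
    moreover have "int (lcm k h) dvd x" using that(3) h by (simp only: eq mem_Collect_eq)
    ultimately have "lcm k h \<in> ?H" by blast
    then have "lcm k h \<le> h" unfolding h_def using fin by (intro Max_ge)
    moreover have "h \<le> lcm k h"
      using dvd_pos_nat[OF n_pos \<open>lcm k h dvd n\<close>] by (intro dvd_imp_le dvd_lcm2)
    ultimately have "lcm k h = h" by (rule le_antisym)
    then show ?thesis using dvd_lcm1[of k h] by simp
  qed
  have H: "resp (\<lambda>i. int h dvd i)" "int h dvd x" "int h dvd y" using h xy by blast+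
  have "r x (int h)"
    by (rule class_contains_generator[OF h_pos H(1,2) max])
  moreover have "r y (int h)"
    by (rule class_contains_generator[OF h_pos H(1,3)]) (use max xy in blast)
  ultimately show ?thesis using equivp_r by (meson equivp_symp equivp_transp)
qed

end

section \<open>Spans of indicators\<close>

lemma sum_fun_apply: "(\<Sum>i\<in>I. F i) x = (\<Sum>i\<in>I. F i x :: rat)"
  by (induction I rule: infinite_finite_induct) auto

text \<open>The pointwise product of two indicators is the indicator of the intersection; the rest
  is bilinearity.\<close>

lemma span_indicator_closed_mult:
  fixes f g :: "'a \<Rightarrow> rat"
  assumes L: "\<And>H K. H \<in> L \<Longrightarrow> K \<in> L \<Longrightarrow> H \<inter> K \<in> L"
    and f: "f \<in> rat_fun.span (indicator ` L)" and g: "g \<in> rat_fun.span (indicator ` L)"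
  shows "(\<lambda>x. f x * g x) \<in> rat_fun.span (indicator ` L)"
proof -
  have ind: "(\<lambda>x. f x * indicator H x) \<in> rat_fun.span (indicator ` L)" if H: "H \<in> L" for H
    using f
  proof (induction rule: rat_fun.span_induct_alt)
    case base
    then show ?case by (simp add: rat_fun.span_zero flip: zero_fun_def)
  next
    case (step c b h)
    then obtain K where K: "K \<in> L" "b = indicator K" by blast
    have "(\<lambda>x. (rat_scale c b + h) x * indicator H x)
        = rat_scale c (indicator (K \<inter> H)) + (\<lambda>x. h x * indicator H x)"
      by (auto simp: K(2) rat_scale_def fun_eq_iff indicator_def algebra_simps)
    then show ?case
      using step.IH L[OF K(1) H] by (simp add: rat_fun.span_add rat_fun.span_scale rat_fun.span_base)
  qed
  show ?thesis
    using g
  proof (induction rule: rat_fun.span_induct_alt)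
    case base
    then show ?case by (simp add: rat_fun.span_zero flip: zero_fun_def)
  next
    case (step c b h)
    then obtain K where K: "K \<in> L" "b = indicator K" by blast
    have "(\<lambda>x. f x * (rat_scale c b + h) x)
        = rat_scale c (\<lambda>x. f x * indicator K x) + (\<lambda>x. f x * h x)"
      by (auto simp: K(2) rat_scale_def fun_eq_iff algebra_simps)
    then show ?case
      using step.IH ind[OF K(1)] by (simp add: rat_fun.span_add rat_fun.span_scale)
  qed
qed

text \<open>Finite Stone-Weierstrass theorem: the indicators of the classes of points that \<open>L\<close> does not
  separate are products of indicators of members of \<open>L\<close> and of complements of such.\<close>

lemma mem_span_indicator_if_separated:
  fixes f :: "'a \<Rightarrow> rat"
  assumes X: "finite X" "X \<in> L" "L \<subseteq> Pow X"
    and L: "\<And>H K. H \<in> L \<Longrightarrow> K \<in> L \<Longrightarrow> H \<inter> K \<in> L"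
    and f0: "\<And>x. x \<notin> X \<Longrightarrow> f x = 0"
    and f: "\<And>x y. x \<in> X \<Longrightarrow> y \<in> X \<Longrightarrow> (\<And>H. H \<in> L \<Longrightarrow> x \<in> H \<longleftrightarrow> y \<in> H) \<Longrightarrow> f x = f y"
  shows "f \<in> rat_fun.span (indicator ` L)"
proof -
  let ?W = "rat_fun.span (indicator ` L) :: ('a \<Rightarrow> rat) set"
  define cls where "cls x = {y \<in> X. \<forall>H\<in>L. x \<in> H \<longleftrightarrow> y \<in> H}" for x
  have finL: "finite L" using X(1,3) by (meson finite_Pow_iff finite_subset)
  have sep: "indicator {y \<in> X. \<forall>H\<in>M. x \<in> H \<longleftrightarrow> y \<in> H} \<in> ?W" if "M \<subseteq> L" for M x
    using finite_subset[OF that finL] that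
  proof induction
    case empty
    then show ?case using X(2) by (simp add: rat_fun.span_base)
  next
    case (insert H M)
    let ?f = "indicator {y \<in> X. \<forall>H\<in>M. x \<in> H \<longleftrightarrow> y \<in> H} :: 'a \<Rightarrow> rat"
    let ?g = "(if x \<in> H then indicator H else indicator X - indicator H) :: 'a \<Rightarrow> rat"
    have "?g \<in> ?W" using insert.prems X(2) by (auto intro: rat_fun.span_base rat_fun.span_diff)
    then have "(\<lambda>y. ?f y * ?g y) \<in> ?W"
      using insert by (intro span_indicator_closed_mult L) auto
    also have "(\<lambda>y. ?f y * ?g y) = indicator {y \<in> X. \<forall>H\<in>insert H M. x \<in> H \<longleftrightarrow> y \<in> H}"
      using insert.prems X(3) by (auto simp: fun_eq_iff indicator_def)
    finally show ?case .
  qed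
  \<comment> \<open>Summing over points counts each class once per element, hence the division by
    \<open>card (cls x)\<close>.\<close>
  have "f = (\<Sum>x\<in>X. rat_scale (f x / of_nat (card (cls x))) (indicator (cls x)))"
  proof
    fix y
    have "(\<Sum>x\<in>X. rat_scale (f x / of_nat (card (cls x))) (indicator (cls x))) y
        = (\<Sum>x\<in>X. f x / of_nat (card (cls x)) * indicator (cls x) y)"
      by (simp add: sum_fun_apply rat_scale_def)
    also have "\<dots> = f y"
    proof (cases "y \<in> X")
      case True
      have eq: "cls x = cls y \<and> f x = f y" if "x \<in> cls y" for x
        using that True f[of x y] by (auto simp: cls_def)
      have "(\<Sum>x\<in>X. f x / of_nat (card (cls x)) * indicator (cls x) y)
          = (\<Sum>x\<in>cls y. f y / of_nat (card (cls y)))"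
      proof (rule sum.mono_neutral_cong_right)
        show "\<forall>x\<in>X - cls y. f x / of_nat (card (cls x)) * indicator (cls x) y = 0"
          by (auto simp: cls_def indicator_def)
        fix x assume x: "x \<in> cls y"
        then have "y \<in> cls x" using True by (auto simp: cls_def)
        then show "f x / of_nat (card (cls x)) * indicator (cls x) y = f y / of_nat (card (cls y))"
          using eq[OF x] by simp
      qed (use X(1) in \<open>auto simp: cls_def\<close>)
      moreover have "y \<in> cls y" "finite (cls y)" using True X(1) by (auto simp: cls_def)
      then have "card (cls y) \<noteq> 0" by auto
      ultimately show ?thesis by simp
    next
      case False
      then have "y \<notin> cls x" for x by (simp add: cls_def)
      then show ?thesis using f0[OF False] by simp
    qed
    finally show "f y = (\<Sum>x\<in>X. rat_scale (f x / of_nat (card (cls x))) (indicator (cls x))) y" ..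
  qed
  also have "\<dots> \<in> ?W"
    by (intro rat_fun.span_sum rat_fun.span_scale) (use sep[OF subset_refl] in \<open>simp add: cls_def\<close>)
  finally show ?thesis .
qed

lemma span_indicator_partition:
  fixes f :: "'a \<Rightarrow> rat"
  assumes P: "partition_on X P" and X: "finite X"
  shows "f \<in> rat_fun.span (indicator ` P)
    \<longleftrightarrow> (\<forall>x. x \<notin> X \<longrightarrow> f x = 0) \<and> (\<forall>C\<in>P. \<forall>x\<in>C. \<forall>y\<in>C. f x = f y)"
proof
  assume "f \<in> rat_fun.span (indicator ` P)"
  then show "(\<forall>x. x \<notin> X \<longrightarrow> f x = 0) \<and> (\<forall>C\<in>P. \<forall>x\<in>C. \<forall>y\<in>C. f x = f y)"
  proof (induction rule: rat_fun.span_induct_alt)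
    case (step c b h)
    then obtain C where C: "C \<in> P" "b = indicator C" by blast
    have "C \<subseteq> X" using partition_onD1[OF P] C(1) by blast
    then have "(rat_scale c b + h) x = 0" if "x \<notin> X" for x
      using that step.IH by (auto simp: C(2) rat_scale_def indicator_def)
    moreover have "(rat_scale c b + h) x = (rat_scale c b + h) y"
      if D: "D \<in> P" "x \<in> D" "y \<in> D" for D x y
    proof -
      have "x \<in> C \<longleftrightarrow> y \<in> C"
        using disjointD[OF partition_onD2[OF P] C(1) D(1)] D(2,3) by blast
      moreover have "h x = h y" using step.IH D by blast
      ultimately show ?thesis by (simp add: C(2) rat_scale_def indicator_def)
    qed
    ultimately show ?case by blast
  qed simp
next
  assume f: "(\<forall>x. x \<notin> X \<longrightarrow> f x = 0) \<and> (\<forall>C\<in>P. \<forall>x\<in>C. \<forall>y\<in>C. f x = f y)"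
  have finP: "finite P" using X P finite_elements by blast
  \<comment> \<open>The chosen representative is irrelevant since \<open>f\<close> is constant on
    \<open>C\<close>.\<close>
  have "f = (\<Sum>C\<in>P. rat_scale (f (SOME x. x \<in> C)) (indicator C))"
  proof
    fix x
    have sum: "(\<Sum>C\<in>P. rat_scale (f (SOME x. x \<in> C)) (indicator C)) x
        = (\<Sum>C\<in>P. f (SOME x. x \<in> C) * indicator C x)"
      by (simp add: sum_fun_apply rat_scale_def)
    show "f x = (\<Sum>C\<in>P. rat_scale (f (SOME x. x \<in> C)) (indicator C)) x"
    proof (cases "x \<in> X")
      case True
      then obtain D where D: "D \<in> P" "x \<in> D" using P by (auto simp: partition_on_def)
      have ind: "indicator C x = (of_bool (C = D) :: rat)" if "C \<in> P" for C
        using disjointD[OF partition_onD2[OF P] that D(1)] D(2) by (auto simp: indicator_def)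
      have "(\<Sum>C\<in>P. f (SOME x. x \<in> C) * indicator C x)
          = (\<Sum>C\<in>P. if C = D then f (SOME x. x \<in> C) else 0)"
        by (rule sum.cong[OF refl]) (simp add: ind)
      also have "\<dots> = f (SOME x. x \<in> D)" using D(1) finP by simp
      also have "\<dots> = f x" using f D someI[of "\<lambda>x. x \<in> D" x] by blast
      finally show ?thesis using sum by simp
    next
      case False
      then have "x \<notin> C" if "C \<in> P" for C using partition_onD1[OF P] that by blast
      then show ?thesis using sum f False by simp
    qed
  qed
  also have "\<dots> \<in> rat_fun.span (indicator ` P)"
    by (intro rat_fun.span_sum rat_fun.span_scale rat_fun.span_base) auto
  finally show "f \<in> rat_fun.span (indicator ` P)" .
qed

text \<open>Extends closure under products from the basic sets, where the Schur ring axiom states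
  it, to the whole span.\<close>

lemma span_closed_bilinear:
  fixes f g :: "'a \<Rightarrow> rat"
  assumes B: "\<And>b c. b \<in> B \<Longrightarrow> c \<in> B \<Longrightarrow> m b c \<in> rat_fun.span B"
    and lin1: "\<And>h. Vector_Spaces.linear rat_scale rat_scale (\<lambda>f. m f h)"
    and lin2: "\<And>h. Vector_Spaces.linear rat_scale rat_scale (\<lambda>f. m h f)"
    and f: "f \<in> rat_fun.span B" and g: "g \<in> rat_fun.span B"
  shows "m f g \<in> rat_fun.span B"
proof -
  interpret l1: Vector_Spaces.linear rat_scale rat_scale "\<lambda>f. m f h" for h by (rule lin1)
  interpret l2: Vector_Spaces.linear rat_scale rat_scale "\<lambda>f. m h f" for h by (rule lin2)
  have 1: "m f c \<in> rat_fun.span B" if c: "c \<in> B" for c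
    using f
  proof (induction rule: rat_fun.span_induct_alt)
    case base
    then show ?case using rat_fun.span_zero by (subst l1.zero)
  next
    case (step k b h)
    then show ?case
      unfolding l1.add l1.scale using B[OF _ c] by (intro rat_fun.span_add rat_fun.span_scale)
  qed
  show ?thesis
    using g
  proof (induction rule: rat_fun.span_induct_alt)
    case base
    then show ?case using rat_fun.span_zero by (subst l2.zero)
  next
    case (step k b h)
    then show ?case
      unfolding l2.add l2.scale using 1 by (intro rat_fun.span_add rat_fun.span_scale)
  qed
qed

lemma linear_rat_group_algebra_mult:
  "Vector_Spaces.linear rat_scale rat_scale (\<lambda>f. f \<otimes>\<^bsub>rat_group_algebra G\<^esub> h)"
  "Vector_Spaces.linear rat_scale rat_scale (\<lambda>f. h \<otimes>\<^bsub>rat_group_algebra G\<^esub> f)"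
  by unfold_locales
    (auto simp: rat_group_algebra_def rat_scale_def fun_eq_iff case_prod_beta sum.distrib
      sum_distrib_left algebra_simps)

text \<open>Makes a rational idempotent integral, so that congruences modulo primes apply to
  it.\<close>

lemma common_denominator:
  fixes f :: "'a \<Rightarrow> rat"
  assumes "finite X"
  shows "\<exists>D::int. D > 0 \<and> (\<forall>x\<in>X. \<exists>a::int. of_int D * f x = of_int a)"
  using assms
proof induction
  case empty
  show ?case by (intro exI[of _ 1]) simp
next
  case (insert x X)
  then obtain D :: int where D: "D > 0" "\<And>y. y \<in> X \<Longrightarrow> \<exists>a::int. of_int D * f y = of_int a" by blast
  obtain a b where ab: "quotient_of (f x) = (a, b)" by (cases "quotient_of (f x)")
  then have b: "b > 0" "f x = of_int a / of_int b"
    using quotient_of_denom_pos quotient_of_div by blast+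
  show ?case
  proof (rule exI[of _ "D * b"], intro conjI ballI)
    fix y assume "y \<in> insert x X"
    then consider "y = x" | "y \<in> X" by blast
    then show "\<exists>c::int. of_int (D * b) * f y = of_int c"
    proof cases
      case 1
      then show ?thesis using b by (intro exI[of _ "D * a"]) simp
    next
      case 2
      then obtain c :: int where "of_int D * f y = of_int c" using D(2) by blast
      then show ?thesis by (intro exI[of _ "b * c"]) (simp add: mult_ac)
    qed
  qed (use D b in simp)
qed

section \<open>Schur rings over cyclic groups\<close>

context group
begin

lemma cyclic_carrier_bij:
  assumes g: "\<gamma> \<in> carrier G" "carrier G = range (\<lambda>i::int. \<gamma> [^] i)" and fin: "finite (carrier G)"
  shows "bij_betw (\<lambda>i. \<gamma> [^] int i) {..<ord \<gamma>} (carrier G)"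
proof -
  have pos: "ord \<gamma> > 0" using ord_ge_1[OF fin g(1)] by simp
  have "inj_on (\<lambda>i. \<gamma> [^] int i) {..<ord \<gamma>}"
  proof (rule inj_onI)
    fix i j assume ij: "i \<in> {..<ord \<gamma>}" "j \<in> {..<ord \<gamma>}" "\<gamma> [^] int i = \<gamma> [^] int j"
    then have "int (ord \<gamma>) dvd int j - int i" using g(1) by (simp only: int_pow_eq)
    then have "int j mod int (ord \<gamma>) = int i mod int (ord \<gamma>)" by (simp add: mod_eq_dvd_iff)
    then show "i = j" using ij by simp
  qed
  moreover have "\<gamma> [^] i \<in> (\<lambda>i. \<gamma> [^] int i) ` {..<ord \<gamma>}" for i :: int
  proof -
    let ?j = "nat (i mod int (ord \<gamma>))"
    have "int (ord \<gamma>) dvd i - int ?j" "?j < ord \<gamma>"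
      using pos by (simp_all add: minus_mod_eq_mult_div nat_less_iff)
    then have "\<gamma> [^] i = \<gamma> [^] int ?j"
      using g(1) int_pow_eq[of \<gamma> "int ?j" i] by simp
    then show ?thesis using \<open>?j < ord \<gamma>\<close> by blast
  qed
  ultimately show ?thesis using g by (auto simp: bij_betw_def)
qed

text \<open>In terms of exponents the product is a convolution over one period, which links it to
  \<open>conv\<close>.\<close>

lemma rat_group_algebra_mult_cyclic:
  assumes g: "\<gamma> \<in> carrier G" "carrier G = range (\<lambda>i::int. \<gamma> [^] i)" and fin: "finite (carrier G)"
  shows "(f \<otimes>\<^bsub>rat_group_algebra G\<^esub> h) (\<gamma> [^] j)
    = (\<Sum>i<ord \<gamma>. f (\<gamma> [^] int i) * h (\<gamma> [^] (j - int i)))"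
proof -
  have "(f \<otimes>\<^bsub>rat_group_algebra G\<^esub> h) (\<gamma> [^] j)
      = (\<Sum>y\<in>carrier G. f y * h (inv y \<otimes> \<gamma> [^] j))"
    by (rule rat_group_algebra_mult) (use g(1) group_axioms in auto)
  also have "\<dots> = (\<Sum>i<ord \<gamma>. f (\<gamma> [^] int i) * h (inv (\<gamma> [^] int i) \<otimes> \<gamma> [^] j))"
    by (rule sum.reindex_bij_betw[OF cyclic_carrier_bij[OF assms], symmetric])
  also have "\<dots> = (\<Sum>i<ord \<gamma>. f (\<gamma> [^] int i) * h (\<gamma> [^] (j - int i)))"
  proof (rule sum.cong[OF refl])
    fix i
    have "inv (\<gamma> [^] int i) \<otimes> \<gamma> [^] j = \<gamma> [^] (- int i + j)"
      using g(1) by (simp only: int_pow_mult int_pow_neg)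
    then show "f (\<gamma> [^] int i) * h (inv (\<gamma> [^] int i) \<otimes> \<gamma> [^] j)
        = f (\<gamma> [^] int i) * h (\<gamma> [^] (j - int i))" by simp
  qed
  finally show ?thesis .
qed

lemma subgroup_multiples:
  assumes g: "\<gamma> \<in> carrier G"
  shows "subgroup {\<gamma> [^] i | i. int h dvd i} G"
proof (rule subgroupI)
  show "{\<gamma> [^] i | i. int h dvd i} \<subseteq> carrier G" using g by auto
  show "{\<gamma> [^] i | i. int h dvd i} \<noteq> {}" by (auto intro!: exI[of _ 0])
next
  fix a assume "a \<in> {\<gamma> [^] i | i. int h dvd i}"
  then obtain i where i: "a = \<gamma> [^] i" "int h dvd i" by blast
  have "inv a = \<gamma> [^] (- i)" "int h dvd - i" using i g by (simp_all add: int_pow_neg)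
  then show "inv a \<in> {\<gamma> [^] i | i. int h dvd i}" by blast
next
  fix a b assume "a \<in> {\<gamma> [^] i | i. int h dvd i}" "b \<in> {\<gamma> [^] i | i. int h dvd i}"
  then obtain i j where ij: "a = \<gamma> [^] i" "int h dvd i" "b = \<gamma> [^] j" "int h dvd j" by blast
  have "a \<otimes> b = \<gamma> [^] (i + j)" "int h dvd i + j" using ij g by (simp_all add: int_pow_mult)
  then show "a \<otimes> b \<in> {\<gamma> [^] i | i. int h dvd i}" by blast
qed

end

locale cyclic_schur_partition = group G for G (structure) +
  fixes \<gamma> and P
  assumes gen: "\<gamma> \<in> carrier G" "carrier G = range (\<lambda>i::int. \<gamma> [^] i)"
    and fin: "finite (carrier G)"
    and P: "partition_on (carrier G) P"
    and one_P: "{\<one>} \<in> P"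
    and mult_P: "\<And>C D. C \<in> P \<Longrightarrow> D \<in> P \<Longrightarrow>
      indicator C \<otimes>\<^bsub>rat_group_algebra G\<^esub> indicator D \<in> rat_fun.span (indicator ` P)"
begin

text \<open>Under \<open>i \<mapsto> \<gamma>\<^sup>i\<close> the functions satisfying \<open>adm\<close> are the integral elements of the Schur ring that are
  constant on the generators of each subgroup; \<open>rel\<close> is the partition into their basic sets.\<close>

definition adm :: "(int \<Rightarrow> int) \<Rightarrow> bool" where
  "adm f \<longleftrightarrow> (\<forall>C\<in>P. \<forall>i j. \<gamma> [^] i \<in> C \<longrightarrow> \<gamma> [^] j \<in> C \<longrightarrow> f i = f j) \<and>
    (\<forall>u i. coprime u (int (ord \<gamma>)) \<longrightarrow> f (u * i) = f i)"

definition rel :: "int \<Rightarrow> int \<Rightarrow> bool" where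
  "rel i j \<longleftrightarrow> (\<forall>f. adm f \<longrightarrow> f i = f j)"

section \<open>From the Schur ring to its rational part\<close>

lemma adm_cell:
  assumes "adm f" "C \<in> P" "\<gamma> [^] i \<in> C" "\<gamma> [^] j \<in> C"
  shows "f i = f j"
  using assms unfolding adm_def by blast

lemma adm_unit: "adm f \<Longrightarrow> coprime u (int (ord \<gamma>)) \<Longrightarrow> f (u * i) = f i"
  unfolding adm_def by blast

lemma relD: "rel i j \<Longrightarrow> adm f \<Longrightarrow> f i = f j"
  unfolding rel_def by blast

lemma rel_cell:
  assumes "C \<in> P" "\<gamma> [^] i \<in> C" "\<gamma> [^] j \<in> C"
  shows "rel i j"
  unfolding rel_def using adm_cell[OF _ assms] by blast

lemma rel_unit:
  assumes "coprime u (int (ord \<gamma>))"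
  shows "rel i (u * i)"
  unfolding rel_def using adm_unit[OF _ assms, symmetric] by blast

text \<open>Both conditions in \<open>adm\<close> are instances of \<open>rel\<close>, so
  \<open>adm\<close> describes exactly the functions constant on the classes of
  \<open>rel\<close>.\<close>

lemma adm_if_respects_rel:
  assumes f: "\<And>i j. rel i j \<Longrightarrow> f i = f j"
  shows "adm f"
  unfolding adm_def
proof (intro conjI ballI allI impI)
  show "f i = f j" if "C \<in> P" "\<gamma> [^] i \<in> C" "\<gamma> [^] j \<in> C" for C i j
    by (rule f[OF rel_cell[OF that]])
  show "f (u * i) = f i" if "coprime u (int (ord \<gamma>))" for u i
    by (rule f[OF rel_unit[OF that], symmetric])
qed

lemma cell_exists: "\<exists>C\<in>P. \<gamma> [^] (i::int) \<in> C"
proof -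
  have "\<gamma> [^] i \<in> \<Union>P" using gen(1) partition_onD1[OF P] int_pow_closed by simp
  then show ?thesis by blast
qed

lemma span_P_iff:
  "f \<in> rat_fun.span (indicator ` P)
    \<longleftrightarrow> (\<forall>x. x \<notin> carrier G \<longrightarrow> f x = 0) \<and> (\<forall>C\<in>P. \<forall>x\<in>C. \<forall>y\<in>C. f x = f y)"
  by (rule span_indicator_partition[OF P fin])

lemma adm_mod:
  assumes f: "adm f" and ij: "int (ord \<gamma>) dvd i - j"
  shows "f i = f j"
proof -
  have eq: "\<gamma> [^] i = \<gamma> [^] j" using int_pow_eq[OF gen(1), of j i] ij by simp
  obtain C where "C \<in> P" "\<gamma> [^] i \<in> C" using cell_exists by blast
  then show ?thesis using adm_cell[OF f, of C i j] eq by simp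
qed

lemma ord_pos: "ord \<gamma> > 0"
  using ord_ge_1[OF fin gen(1)] by simp

text \<open>The chosen exponent does not matter for \<open>adm f\<close>, which implies
  periodicity.\<close>

definition lift :: "(int \<Rightarrow> int) \<Rightarrow> 'a \<Rightarrow> rat" where
  "lift f x = (if x \<in> carrier G then of_int (f (SOME i. x = \<gamma> [^] i)) else 0)"

lemma lift_pow:
  assumes "adm f"
  shows "lift f (\<gamma> [^] i) = of_int (f i)"
proof -
  have "\<gamma> [^] i = \<gamma> [^] (SOME j::int. \<gamma> [^] i = \<gamma> [^] j)"
    by (rule someI[of "\<lambda>j::int. \<gamma> [^] i = \<gamma> [^] j" i]) (rule refl)
  then have "int (ord \<gamma>) dvd (SOME j::int. \<gamma> [^] i = \<gamma> [^] j) - i"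
    by (rule int_pow_eq[OF gen(1), THEN iffD1])
  then have "f (SOME j::int. \<gamma> [^] i = \<gamma> [^] j) = f i" by (rule adm_mod[OF assms])
  then show ?thesis using gen(1) by (simp add: lift_def)
qed

lemma lift_in_span:
  assumes "adm f"
  shows "lift f \<in> rat_fun.span (indicator ` P)"
  unfolding span_P_iff
proof (intro conjI allI impI ballI)
  fix C x y assume C: "C \<in> P" "x \<in> C" "y \<in> C"
  then have "x \<in> carrier G" "y \<in> carrier G" using partition_onD1[OF P] by blast+
  then obtain i j where ij: "x = \<gamma> [^] (i::int)" "y = \<gamma> [^] (j::int)" using gen(2) by blast
  then have "f i = f j" using C adm_cell[OF assms] by blast
  then show "lift f x = lift f y" by (simp only: ij lift_pow[OF assms])
qed (simp add: lift_def)

text \<open>Constancy on basic sets comes from the product in the group algebra, unit invariance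
  from substituting \<open>u * i\<close> for \<open>i\<close>.\<close>

lemma adm_conv:
  assumes f: "adm f" and h: "adm h"
  shows "adm (conv (ord \<gamma>) f h)"
  unfolding adm_def
proof (intro conjI ballI allI impI)
  fix C i j assume C: "C \<in> P" "\<gamma> [^] (i::int) \<in> C" "\<gamma> [^] (j::int) \<in> C"
  let ?m = "lift f \<otimes>\<^bsub>rat_group_algebra G\<^esub> lift h"
  have m: "?m (\<gamma> [^] t) = of_int (conv (ord \<gamma>) f h t)" for t
    unfolding rat_group_algebra_mult_cyclic[OF gen fin] lift_pow[OF f] lift_pow[OF h] conv_def
    by simp
  have "?m \<in> rat_fun.span (indicator ` P)"
    by (rule span_closed_bilinear[where m = "\<lambda>f h. f \<otimes>\<^bsub>rat_group_algebra G\<^esub> h"])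
      (use mult_P linear_rat_group_algebra_mult lift_in_span f h in auto)
  then have "?m (\<gamma> [^] i) = ?m (\<gamma> [^] j)" using C unfolding span_P_iff by blast
  then show "conv (ord \<gamma>) f h i = conv (ord \<gamma>) f h j" by (simp add: m)
next
  fix u y assume u: "coprime u (int (ord \<gamma>))"
  have unit: "f (u * i) = f i" "h (u * i) = h i" for i by (rule adm_unit[OF f u] adm_unit[OF h u])+
  have "conv (ord \<gamma>) f h (u * y) = (\<Sum>i<ord \<gamma>. f (u * int i) * h (u * y - u * int i))"
    unfolding conv_def
  proof (rule sum_mod_period[symmetric, OF ord_pos])
    fix i j assume ij: "int (ord \<gamma>) dvd i - j"
    then have "int (ord \<gamma>) dvd (u * y - j) - (u * y - i)" by simp
    from adm_mod[OF h this] adm_mod[OF f ij]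
    show "f i * h (u * y - i) = f j * h (u * y - j)" by simp
  next
    fix i j assume "int (ord \<gamma>) dvd u * i - u * j"
    then have "int (ord \<gamma>) dvd u * (i - j)" by (simp add: right_diff_distrib)
    then show "int (ord \<gamma>) dvd i - j"
      using u by (simp add: coprime_dvd_mult_right_iff coprime_commute)
  qed
  also have "\<dots> = conv (ord \<gamma>) f h y"
    unfolding conv_def right_diff_distrib[symmetric] unit ..
  finally show "conv (ord \<gamma>) f h (u * y) = conv (ord \<gamma>) f h y" .
qed

text \<open>The identity forms a basic set of its own and is fixed by units; this keeps
  \<open>0\<close> separated from the other residues.\<close>

lemma adm_zero: "adm (\<lambda>i. of_bool (int (ord \<gamma>) dvd i))"
  unfolding adm_def
proof (intro conjI ballI allI impI)
  have *: "int (ord \<gamma>) dvd j"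
    if C: "C \<in> P" "\<gamma> [^] i \<in> C" "\<gamma> [^] j \<in> C" and i: "int (ord \<gamma>) dvd i" for C i j
  proof -
    have "\<gamma> [^] i = \<one>" using i int_pow_eq_id[OF gen(1)] by blast
    then have "C = {\<one>}"
      using disjointD[OF partition_onD2[OF P] C(1) one_P] C(2) by auto
    then have "\<gamma> [^] j = \<one>" using C(3) by simp
    then show ?thesis using int_pow_eq_id[OF gen(1)] by blast
  qed
  fix C i j assume "C \<in> P" "\<gamma> [^] (i::int) \<in> C" "\<gamma> [^] (j::int) \<in> C"
  then have "int (ord \<gamma>) dvd i \<longleftrightarrow> int (ord \<gamma>) dvd j" using * by blast
  then show "of_bool (int (ord \<gamma>) dvd i) = (of_bool (int (ord \<gamma>) dvd j) :: int)" by simp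
next
  fix u i assume "coprime u (int (ord \<gamma>))"
  then show "of_bool (int (ord \<gamma>) dvd u * i) = (of_bool (int (ord \<gamma>) dvd i) :: int)"
    by (simp add: coprime_dvd_mult_right_iff coprime_commute)
qed

sublocale rational_schur_relation "ord \<gamma>" rel
proof
  show "ord \<gamma> > 0" by (rule ord_pos)
  show "equivp rel"
    by (rule equivpI) (auto simp: rel_def reflp_def symp_def transp_def)
next
  fix i assume "rel 0 i"
  from relD[OF this adm_zero] show "int (ord \<gamma>) dvd i" by simp
next
  fix i j assume "int (ord \<gamma>) dvd i - j"
  then show "rel i j" unfolding rel_def using adm_mod by blast
next
  fix u i assume "coprime u (int (ord \<gamma>))"
  then show "rel i (u * i)" by (rule rel_unit)
next
  fix f h :: "int \<Rightarrow> int" and i j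
  assume "\<And>i j. rel i j \<Longrightarrow> f i = f j" "\<And>i j. rel i j \<Longrightarrow> h i = h j" "rel i j"
  then show "conv (ord \<gamma>) f h i = conv (ord \<gamma>) f h j"
    by (intro relD[OF \<open>rel i j\<close>] adm_conv adm_if_respects_rel)
qed

text \<open>After clearing denominators, \<open>idempotent_unit_mult\<close> supplies the unit
  invariance required by \<open>adm\<close>.\<close>

lemma idempotent_respects_rel:
  assumes e: "\<epsilon> \<in> rat_fun.span (indicator ` P)"
    and idem: "\<epsilon> \<otimes>\<^bsub>rat_group_algebra G\<^esub> \<epsilon> = \<epsilon>" and ij: "rel i j"
  shows "\<epsilon> (\<gamma> [^] i) = \<epsilon> (\<gamma> [^] j)"
proof -
  obtain D :: int where D: "D > 0" "\<And>x. x \<in> carrier G \<Longrightarrow> \<exists>a::int. of_int D * \<epsilon> x = of_int a"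
    using common_denominator[OF fin, of \<epsilon>] by blast
  then have "\<exists>a::int. of_int D * \<epsilon> (\<gamma> [^] i) = of_int a" for i :: int
    using gen(1) by simp
  then obtain f :: "int \<Rightarrow> int" where f: "of_int D * \<epsilon> (\<gamma> [^] i) = of_int (f i)" for i
    by metis
  have f_eq: "f i = f j \<longleftrightarrow> \<epsilon> (\<gamma> [^] i) = \<epsilon> (\<gamma> [^] j)" for i j
  proof -
    have "f i = f j \<longleftrightarrow> (of_int (f i) :: rat) = of_int (f j)" by simp
    also have "\<dots> \<longleftrightarrow> \<epsilon> (\<gamma> [^] i) = \<epsilon> (\<gamma> [^] j)" using D(1) by (simp flip: f)
    finally show ?thesis .
  qed
  have per: "f i = f j" if "int (ord \<gamma>) dvd i - j" for i j
    using int_pow_eq[OF gen(1), of j i] that by (simp add: f_eq)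
  have conv: "conv (ord \<gamma>) f f y = D * f y" for y
  proof -
    have "(of_int (conv (ord \<gamma>) f f y) :: rat)
        = of_int D * of_int D * (\<Sum>i<ord \<gamma>. \<epsilon> (\<gamma> [^] int i) * \<epsilon> (\<gamma> [^] (y - int i)))"
      by (simp add: conv_def sum_distrib_left mult_ac flip: f)
    also have "\<dots> = of_int D * of_int D * \<epsilon> (\<gamma> [^] y)"
      by (simp only: rat_group_algebra_mult_cyclic[OF gen fin, symmetric] idem)
    also have "\<dots> = of_int (D * f y)" by (simp add: mult.assoc f)
    finally show ?thesis by (simp only: of_int_eq_iff)
  qed
  have "f (u * x) = f x" if "coprime u (int (ord \<gamma>))" for u x
    by (rule idempotent_unit_mult[where f = f, OF ord_pos D(1) per conv that])
  moreover have "f i = f j" if "C \<in> P" "\<gamma> [^] i \<in> C" "\<gamma> [^] j \<in> C" for C i j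
    using e that unfolding span_P_iff f_eq by blast
  ultimately have "adm f" unfolding adm_def by blast
  then show ?thesis using relD[OF ij] f_eq by blast
qed

text \<open>Stone-Weierstrass for the subgroups in the Schur ring: elements they do not separate are
  related by \<open>rel\<close>, and an idempotent is constant on its classes.\<close>

lemma idempotent_in_span_subgroups:
  assumes e: "\<epsilon> \<in> rat_fun.span (indicator ` P)"
    and idem: "\<epsilon> \<otimes>\<^bsub>rat_group_algebra G\<^esub> \<epsilon> = \<epsilon>"
  shows "\<epsilon> \<in> rat_fun.span
    (indicator ` {H. subgroup H G \<and> indicator H \<in> rat_fun.span (indicator ` P)})"
proof (rule mem_span_indicator_if_separated[OF fin])
  let ?L = "{H. subgroup H G \<and> (indicator H :: 'a \<Rightarrow> rat) \<in> rat_fun.span (indicator ` P)}"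
  have L: "H \<in> ?L \<longleftrightarrow> subgroup H G \<and> (\<forall>C\<in>P. \<forall>x\<in>C. \<forall>y\<in>C. x \<in> H \<longleftrightarrow> y \<in> H)" for H
  proof -
    have "\<forall>x. x \<notin> carrier G \<longrightarrow> indicator H x = (0::rat)" if "subgroup H G"
      using subgroup.subset[OF that] by (auto simp: indicator_def)
    moreover have ind: "(indicator H x :: rat) = indicator H y \<longleftrightarrow> (x \<in> H \<longleftrightarrow> y \<in> H)" for x y
      by (simp add: indicator_def)
    ultimately show ?thesis unfolding mem_Collect_eq span_P_iff ind by blast
  qed
  have "x \<in> carrier G" if "C \<in> P" "x \<in> C" for C x
    using partition_onD1[OF P] that by blast
  then show "carrier G \<in> ?L" unfolding L using subgroup_self by simp
  show "?L \<subseteq> Pow (carrier G)"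
  proof
    fix H assume "H \<in> ?L"
    then show "H \<in> Pow (carrier G)" using subgroup.subset[of H G] by simp
  qed
  show "H \<inter> K \<in> ?L" if HK: "H \<in> ?L" "K \<in> ?L" for H K
  proof -
    have "subgroup H G" "subgroup K G" using HK by simp_all
    moreover have "x \<in> H \<inter> K \<longleftrightarrow> y \<in> H \<inter> K" if "C \<in> P" "x \<in> C" "y \<in> C" for C x y
    proof -
      have "x \<in> H \<longleftrightarrow> y \<in> H" "x \<in> K \<longleftrightarrow> y \<in> K" using HK that unfolding L by blast+
      then show ?thesis by simp
    qed
    ultimately show ?thesis unfolding L using subgroups_Inter_pair by blast
  qed
  show "\<epsilon> x = 0" if "x \<notin> carrier G" for x
    using e that unfolding span_P_iff by simp
  fix x y assume xy: "x \<in> carrier G" "y \<in> carrier G" "\<And>H. H \<in> ?L \<Longrightarrow> x \<in> H \<longleftrightarrow> y \<in> H"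
  then obtain i j where ij: "x = \<gamma> [^] (i::int)" "y = \<gamma> [^] (j::int)" using gen(2) by blast
  have "rel i j"
  proof (rule subgroups_separate_classes)
    fix h assume h: "h dvd ord \<gamma>" "resp (\<lambda>i. int h dvd i)"
    \<comment> \<open>As \<open>h\<close> divides the order of \<gamma>, membership in
      \<open>H\<close> can be read off from any exponent.\<close>
    define H where "H = {\<gamma> [^] i | i. int h dvd i}"
    have H: "\<gamma> [^] t \<in> H \<longleftrightarrow> int h dvd t" for t :: int
    proof
      assume "\<gamma> [^] t \<in> H"
      then obtain i where i: "int h dvd i" "\<gamma> [^] i = \<gamma> [^] t" unfolding H_def by auto
      then have "int (ord \<gamma>) dvd t - i" using int_pow_eq[OF gen(1)] by blast
      then have "int h dvd t - i" using h(1) by (meson dvd_trans of_nat_dvd_iff)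
      then show "int h dvd t" using dvd_add[OF _ i(1)] by fastforce
    qed (auto simp: H_def)
    have "H \<in> ?L"
      unfolding L
    proof (intro conjI ballI)
      show "subgroup H G" unfolding H_def by (rule subgroup_multiples[OF gen(1)])
      fix C a b assume C: "C \<in> P" "a \<in> C" "b \<in> C"
      then have "a \<in> carrier G" "b \<in> carrier G" using partition_onD1[OF P] by blast+
      then obtain s t where st: "a = \<gamma> [^] (s::int)" "b = \<gamma> [^] (t::int)" using gen(2) by blast
      then have "rel s t" using C rel_cell by blast
      then show "a \<in> H \<longleftrightarrow> b \<in> H" using h(2) unfolding st H resp_def by blast
    qed
    from xy(3)[OF this] show "int h dvd i \<longleftrightarrow> int h dvd j" unfolding ij H .
  qed
  then show "\<epsilon> x = \<epsilon> y" unfolding ij by (rule idempotent_respects_rel[OF e idem])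
qed

end

theorem corollary3p4:
  fixes G :: "('a, 'b) monoid_scheme" and S :: "('a \<Rightarrow> rat) set" and \<epsilon> :: "'a \<Rightarrow> rat"
  assumes "group G" and "finite (carrier G)" and "cyclic_group G"
    and "schur_ring G S"
    and "\<epsilon> \<in> S" and "\<epsilon> \<otimes>\<^bsub>rat_group_algebra G\<^esub> \<epsilon> = \<epsilon>"
  shows "\<epsilon> \<in> rat_fun.span {indicator H | H. subgroup H G \<and> indicator H \<in> S}"
proof -
  interpret group G by fact
  obtain \<gamma> where g: "\<gamma> \<in> carrier G" "carrier G = range (\<lambda>i::int. \<gamma> [^]\<^bsub>G\<^esub> i)"
    using assms(3) unfolding cyclic_group by blast
  obtain P where P: "partition_on (carrier G) P" "{\<one>\<^bsub>G\<^esub>} \<in> P"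
    "\<And>C D. C \<in> P \<Longrightarrow> D \<in> P \<Longrightarrow> indicator C \<otimes>\<^bsub>rat_group_algebra G\<^esub> indicator D
      \<in> rat_fun.span (indicator ` P)"
    and S: "S = rat_fun.span (indicator ` P)"
    using assms(4) unfolding schur_ring_def by blast
  interpret cyclic_schur_partition G \<gamma> P
    by unfold_locales (use g assms(2) P in auto)
  have "{indicator H | H. subgroup H G \<and> indicator H \<in> S}
      = (indicator ` {H. subgroup H G \<and> indicator H \<in> S} :: ('a \<Rightarrow> rat) set)" by blast
  then show ?thesis
    using idempotent_in_span_subgroups assms(5,6) unfolding S by simp
qed

end
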